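(* Let $\mathcal{D}=\{(D_j,p_j)\}_{j\ge1}$ and $\mathcal{G}=\{(G_j,q_j)\}_{j\ge1}$ be sequences of pointed domains in $\mathbb{C}^n$ tamed at $\hat p$ and $\hat q$, respectively, and suppose there are taut domains $\widetilde D$ and $\widetilde G$ in $\mathbb{C}^n$ such that $D_j\subset\widetilde D$ and $G_j\subset\widetilde G$ for every $j\ge1$. Let $\{f_j\}_{j\ge1}$ be a sequence of biholomorphic maps $f_j\colon D_j\to G_j$ (from $D_j$ onto $G_j$) with $f_j(p_j)=q_j$ for every $j\geq 1$. Then there is a subsequence $\{f_{j_k}\}_{k\ge1}$ of $\{f_j\}_{j\ge1}$ such that the following hold: (1) the corresponding subsequences $\{(D_{j_k},p_{j_k})\}_{k\ge1}$ of $\mathcal{D}$ and $\{(G_{j_k},q_{j_k})\}_{k\ge1}$ of $\mathcal{G}$ converge in the sense of Carathéodory to their own kernels $(\hat D,\hat p)$ and $(\hat G,\hat q)$, respectively; (2) every subsequential limit $\hat f$ (with respect to the compact-open topology) of $\{f_{j_k}\}_{k\ge1}$ is a biholomorphism from $\hat D$ onto $\hat G$ with $\hat f(\hat p)=\hat q$.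
   Context: A pointed set is a pair $(G,p)$ consisting of a set $G$ and a point $p\in G$; it is a pointed domain if $G$ is a connected open set. Two pointed sets are equal if the sets and the points agree. A sequence $\{(G_j,p_j)\}_{j\ge1}$ of pointed domains in $\mathbb{C}^n$ is tamed at $\hat p\in\mathbb{C}^n$ if (1) $\lim_{j\to\infty}p_j=\hat p$, and (2) there is an open neighborhood of $\hat p$ contained in $\bigcap_{j\ge k}G_j$ for some $k\ge1$. $A^\circ$ denotes the interior of $A$, and $\operatorname{Conn}_q(A)$ denotes the connected component of $A$ containing $q$ (empty if $q\notin A$). The Carathéodory kernel (or kernel) of a sequence of pointed domains tamed at $\hat p$ is the pointed set $$\mathbf{Ker}_{\hat p}\{(G_j,p_j)\}_{j\ge1}:=\Big(\bigcup_{k\ge1}\operatorname{Conn}_{\hat p}\Big(\big(\bigcap_{j\ge k}G_j\big)^\circ\Big),\ \hat p\Big).$$ A sequence of pointed domains tamed at $\hat p$ converges (to its kernel, in the sense of Carathéodory) if each of its subsequences has the same kernel as the whole sequence. For a complex manifold $M$ and a domain $G\subset\mathbb{C}^n$, $\mathcal{O}(M,G)$ denotes the family of holomorphic maps from $M$ into $G$. A sequence $\{f_j\}\subset\mathcal{O}(M,G)$ is compactly divergent on $M$ if for any $K\Subset M$ and $L\Subset G$ there exists $j_0\ge1$ with $f_j(K)\cap L=\varnothing$ for every $j\ge j_0$. A subfamily $\mathcal{F}$ of $\mathcal{O}(M,G)$ is a normal family if every sequence in $\mathcal{F}$ contains a subsequence that converges locally uniformly, or a subsequence compactly divergent on $M$.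 A domain $G\subset\mathbb{C}^n$ is taut if for any complex manifold $M$ the collection $\mathcal{O}(M,G)$ is a normal family. A subsequential limit of $\{f_{j_k}\}$ with respect to the compact-open topology is a map $\hat f$ on $\hat D$ to which some subsequence of $\{f_{j_k}\}$ converges uniformly on each compact subset of $\hat D$ (each compact subset of $\hat D$ is contained in $D_{j_k}$ for all sufficiently large $k$, so this makes sense). *)

theory Defs
  imports "HOL-Analysis.Analysis"
begin

section \<open>Pointed domains and Caratheodory kernels\<close>

text \<open>Sequences are indexed by all natural numbers, starting at 0.\<close>

type_synonym 'a pointed_set = "'a set \<times> 'a"

definition pointed_domain :: "'a::topological_space pointed_set \<Rightarrow> bool" where
  "pointed_domain P \<longleftrightarrow> open (fst P) \<and> connected (fst P) \<and> snd P \<in> fst P"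

definition tamed_at :: "(nat \<Rightarrow> 'a::topological_space pointed_set) \<Rightarrow> 'a \<Rightarrow> bool" where
  "tamed_at P p \<longleftrightarrow>
     (\<forall>j. pointed_domain (P j)) \<and>
     (\<lambda>j. snd (P j)) \<longlonglongrightarrow> p \<and>
     (\<exists>k U. open U \<and> p \<in> U \<and> U \<subseteq> (\<Inter>j\<in>{k..}. fst (P j)))"

definition Ker :: "'a::topological_space \<Rightarrow> (nat \<Rightarrow> 'a pointed_set) \<Rightarrow> 'a pointed_set" where
  "Ker p P = (\<Union>k. connected_component_set (interior (\<Inter>j\<in>{k..}. fst (P j))) p, p)"

definition converges_Caratheodory ::
    "(nat \<Rightarrow> 'a::topological_space pointed_set) \<Rightarrow> 'a \<Rightarrow> bool" where
  "converges_Caratheodory P p \<longleftrightarrow> (\<forall>s. strict_mono s \<longrightarrow> Ker p (P \<circ> s) = Ker p P)"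

section \<open>Holomorphic maps between domains\<close>

text \<open>Complex differentiability at every point, i.e. the real Frechet derivative exists and is
  complex linear. Only used for open sets.\<close>

definition holomorphic_map_on :: "(complex^'n \<Rightarrow> complex^'m) \<Rightarrow> (complex^'n) set \<Rightarrow> bool" where
  "holomorphic_map_on f S \<longleftrightarrow>
     (\<forall>x\<in>S. \<exists>f'. (f has_derivative f') (at x within S) \<and> (\<forall>c v. f' (c *s v) = c *s f' v))"

definition biholomorphic_map ::
    "(complex^'n \<Rightarrow> complex^'m) \<Rightarrow> (complex^'n) set \<Rightarrow> (complex^'m) set \<Rightarrow> bool" where
  "biholomorphic_map f S T \<longleftrightarrow>
     bij_betw f S T \<and> holomorphic_map_on f S \<and> holomorphic_map_on (inv_into S f) T"

text \<open>The functions are total; only their values on the relevant sets matter. If every compact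
  subset of \<open>S\<close> lies in the domain of all but finitely many \<open>f j\<close>, the values of
  \<open>f j\<close> outside its domain play no role here.\<close>

definition subsequential_limit ::
    "(complex^'n) set \<Rightarrow> (nat \<Rightarrow> complex^'n \<Rightarrow> complex^'m) \<Rightarrow> (complex^'n \<Rightarrow> complex^'m) \<Rightarrow> bool" where
  "subsequential_limit S f g \<longleftrightarrow>
     (\<exists>s. strict_mono s \<and>
          (\<forall>K. compact K \<and> K \<subseteq> S \<longrightarrow> uniform_limit K (\<lambda>k. f (s k)) g sequentially))"

section \<open>Complex manifolds\<close>

text \<open>The dimension of a manifold has to be quantified inside a formula, so the model space
  \<open>\<complex>\<^sup>m\<close> is the set of all \<open>z :: nat \<Rightarrow> complex\<close> with
  \<open>z i = 0\<close> for \<open>i \<ge> m\<close>, as in \<^const>\<open>Euclidean_space\<close>.\<close>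

definition complex_space :: "nat \<Rightarrow> (nat \<Rightarrow> complex) topology" where
  "complex_space m = top_of_set {z. \<forall>i\<ge>m. z i = 0}"

text \<open>Complex differentiability of a scalar function on an open subset of \<open>\<complex>\<^sup>m\<close>,
  with the complex linear derivative given by its coefficients \<open>a 0, ..., a (m - 1)\<close>.\<close>

definition holomorphic_fun_on :: "nat \<Rightarrow> ((nat \<Rightarrow> complex) \<Rightarrow> complex) \<Rightarrow> (nat \<Rightarrow> complex) set \<Rightarrow> bool" where
  "holomorphic_fun_on m h S \<longleftrightarrow>
     (\<forall>z\<in>S. \<exists>a. ((\<lambda>w. norm (h w - h z - (\<Sum>i<m. a i * (w i - z i)))
                        / L2_set (\<lambda>i. norm (w i - z i)) {..<m}) \<longlongrightarrow> 0) (at z within S))"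

type_synonym 'a atlas = "('a set \<times> ('a \<Rightarrow> nat \<Rightarrow> complex)) set"

text \<open>Manifolds are Hausdorff, second countable and connected; the dimension \<open>m\<close> is arbitrary.
  Connectedness is part of the convention behind normality in the sense used below: on a
  disconnected \<open>M\<close>, a sequence can converge on one component and diverge compactly on another.\<close>

definition complex_manifold :: "nat \<Rightarrow> 'a topology \<Rightarrow> 'a atlas \<Rightarrow> bool" where
  "complex_manifold m M \<A> \<longleftrightarrow>
     Hausdorff_space M \<and> second_countable M \<and> connected_space M \<and>
     (\<Union>(U, \<phi>)\<in>\<A>. U) = topspace M \<and>
     (\<forall>(U, \<phi>)\<in>\<A>. openin M U \<and> openin (complex_space m) (\<phi> ` U) \<and>
        homeomorphic_map (subtopology M U) (subtopology (complex_space m) (\<phi> ` U)) \<phi>) \<and>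
     (\<forall>(U, \<phi>)\<in>\<A>. \<forall>(V, \<psi>)\<in>\<A>. \<forall>i<m.
        holomorphic_fun_on m (\<lambda>z. \<psi> (inv_into U \<phi> z) i) (\<phi> ` (U \<inter> V)))"

definition holomorphic_maps ::
    "nat \<Rightarrow> 'a topology \<Rightarrow> 'a atlas \<Rightarrow> (complex^'n) set \<Rightarrow> ('a \<Rightarrow> complex^'n) set" where
  "holomorphic_maps m M \<A> G =
     {f. f ` topspace M \<subseteq> G \<and>
         (\<forall>(U, \<phi>)\<in>\<A>. \<forall>i. holomorphic_fun_on m (\<lambda>z. f (inv_into U \<phi> z) $ i) (\<phi> ` U))}"

section \<open>Normal families and taut domains\<close>

definition relatively_compact_in :: "'a topology \<Rightarrow> 'a set \<Rightarrow> bool" where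
  "relatively_compact_in X K \<longleftrightarrow> K \<subseteq> topspace X \<and> compactin X (X closure_of K)"

definition compactly_divergent ::
    "'a topology \<Rightarrow> 'b::topological_space set \<Rightarrow> (nat \<Rightarrow> 'a \<Rightarrow> 'b) \<Rightarrow> bool" where
  "compactly_divergent M G f \<longleftrightarrow>
     (\<forall>K L. relatively_compact_in M K \<and> relatively_compact_in (top_of_set G) L \<longrightarrow>
        (\<exists>j0. \<forall>j\<ge>j0. f j ` K \<inter> L = {}))"

definition locally_uniform_limit ::
    "'a topology \<Rightarrow> (nat \<Rightarrow> 'a \<Rightarrow> 'b::metric_space) \<Rightarrow> ('a \<Rightarrow> 'b) \<Rightarrow> bool" where
  "locally_uniform_limit M f g \<longleftrightarrow>
     (\<forall>x\<in>topspace M. \<exists>U. openin M U \<and> x \<in> U \<and> uniform_limit U f g sequentially)"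

text \<open>Convergence is meant in \<open>\<O>(M, G)\<close>: the limit is again a holomorphic map into
  \<open>G\<close>, rather than into its closure.\<close>

definition normal_family ::
    "nat \<Rightarrow> 'a topology \<Rightarrow> 'a atlas \<Rightarrow> (complex^'n) set \<Rightarrow> ('a \<Rightarrow> complex^'n) set \<Rightarrow> bool" where
  "normal_family m M \<A> G \<F> \<longleftrightarrow> \<F> \<subseteq> holomorphic_maps m M \<A> G \<and>
     (\<forall>f :: nat \<Rightarrow> 'a \<Rightarrow> complex^'n. range f \<subseteq> \<F> \<longrightarrow>
        (\<exists>s. strict_mono s \<and>
           ((\<exists>g\<in>holomorphic_maps m M \<A> G. locally_uniform_limit M (f \<circ> s) g) \<or>
            compactly_divergent M G (f \<circ> s))))"

text \<open>A definition cannot quantify over types, so the points of \<open>M\<close> are taken from the fixed type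
  \<open>nat \<Rightarrow> complex\<close>; the topology and the atlas of \<open>M\<close> are arbitrary. This loses no
  manifold: a second countable Hausdorff manifold has at most continuum many points, so its
  structure can be transported to a subset of this type.\<close>

definition taut :: "(complex^'n) set \<Rightarrow> bool" where
  "taut G \<longleftrightarrow> open G \<and> connected G \<and>
     (\<forall>m (M :: (nat \<Rightarrow> complex) topology) \<A>. complex_manifold m M \<A> \<longrightarrow>
        normal_family m M \<A> G (holomorphic_maps m M \<A> G))"

end

theory Submission
  imports Defs "HOL-Complex_Analysis.Great_Picard" "HOL-Library.Diagonal_Subsequence"
begin

text \<open>
  The kernel of \<open>(D j, p j)\<close> is the component of \<open>p_hat\<close> in the open set of all points with a
  neighbourhood contained in \<open>D j\<close> for all large \<open>j\<close>. A diagonal argument over a countable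
  base makes this set invariant under subsequences, which yields Caratheodory convergence.

  Let \<open>f_hat\<close> be a limit of the \<open>f j\<close>. By tautness of \<open>D_taut\<close> the inverses of the \<open>f j\<close>
  subconverge near each point of \<open>G_hat\<close>; they cannot diverge compactly because they map \<open>q j\<close>
  to \<open>p j\<close>. The limits are inverse to each other near \<open>p_hat\<close> and \<open>q_hat\<close>, so both have a nonzero
  Jacobian determinant there, hence everywhere by Hurwitz's theorem. A locally uniform limit with
  nonzero Jacobian determinant is stably open: each image point has a neighbourhood covered by \<open>f j\<close>
  for all large \<open>j\<close>. So \<open>f_hat\<close> maps \<open>D_hat\<close> into \<open>G_hat\<close> and the limits of the inverses map into
  \<open>D_hat\<close>, and passing to the limit in the identities for the inverse shows that they are inverse
  to \<open>f_hat\<close>.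
\<close>

section \<open>Holomorphic maps in several variables\<close>

lemma norm_vector_smult: "norm (c *s v) = norm c * norm (v :: complex^'n)"
  by (simp add: norm_vec_def norm_mult L2_set_right_distrib)

lemma scaleR_eq_smult: "r *\<^sub>R v = complex_of_real r *s v"
  by (vector scaleR_conv_of_real)

lemma continuous_on_matrix_vector_mult_right [continuous_intros]:
  fixes M :: "complex^'n^'m"
  shows "continuous_on S f \<Longrightarrow> continuous_on S (\<lambda>x. M *v f x)"
  unfolding matrix_vector_mult_def by (intro continuous_intros)

text \<open>A crude entrywise bound suffices: it converts convergence of Jacobian entries into the
  operator estimate that \<open>has_derivative_sequence\<close> asks for.\<close>

lemma norm_matrix_vector_mult_le:
  fixes M :: "complex^'n^'m"
  assumes "\<And>i k. norm (M $ i $ k) \<le> e"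
  shows "norm (M *v v) \<le> real CARD('m) * real CARD('n) * e * norm v"
proof -
  have "norm ((M *v v) $ i) \<le> real CARD('n) * (e * norm v)" for i
  proof -
    have "norm ((M *v v) $ i) \<le> (\<Sum>k\<in>UNIV. norm (M $ i $ k * v $ k))"
      unfolding matrix_vector_mult_def by (simp add: norm_sum)
    also have "\<dots> \<le> (\<Sum>k\<in>(UNIV::'n set). e * norm v)"
      using assms Finite_Cartesian_Product.norm_nth_le[of v] order_trans[OF norm_ge_zero assms]
      by (intro sum_mono) (simp add: norm_mult mult_mono)
    finally show ?thesis by simp
  qed
  then have "(\<Sum>i\<in>UNIV. norm ((M *v v) $ i)) \<le> (\<Sum>i\<in>(UNIV::'m set). real CARD('n) * (e * norm v))"
    by (intro sum_mono)
  moreover have "norm (M *v v) \<le> (\<Sum>i\<in>UNIV. norm ((M *v v) $ i))"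
    unfolding norm_vec_def by (rule L2_set_le_sum) simp
  ultimately show ?thesis
    by (simp add: mult.assoc)
qed

section \<open>Complex Jacobians and restriction to complex lines\<close>

text \<open>The entries are one-variable derivatives along coordinate lines, so that Cauchy's
  inequality applies to them directly, even before \<open>f\<close> is known to be differentiable as
  a map.\<close>

definition complex_jacobian :: "(complex^'n \<Rightarrow> complex^'m) \<Rightarrow> complex^'n \<Rightarrow> complex^'n^'m" where
  "complex_jacobian f x = (\<chi> i k. deriv (\<lambda>t. f (x + t *s axis k 1) $ i) 0)"

lemma holomorphic_map_on_subset:
  assumes "holomorphic_map_on f S" "T \<subseteq> S"
  shows "holomorphic_map_on f T"
  using assms unfolding holomorphic_map_on_def by (meson has_derivative_subset subsetD)

lemma holomorphic_map_on_imp_continuous_on: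
  "holomorphic_map_on f S \<Longrightarrow> continuous_on S f"
  unfolding holomorphic_map_on_def
  by (meson continuous_on_eq_continuous_within has_derivative_continuous)

lemma holomorphic_map_onI:
  assumes "\<And>x. x \<in> S \<Longrightarrow> (f has_derivative (\<lambda>v. M x *v v)) (at x within S)"
  shows "holomorphic_map_on f S"
  unfolding holomorphic_map_on_def
  using assms vec.linear_scale[OF matrix_vector_mul_linear_gen] by blast

text \<open>Chain rule along the complex line; complex linearity of \<open>f'\<close> turns the real
  derivative into multiplication by a complex number.\<close>

lemma line_has_field_derivative:
  fixes f :: "complex^'n \<Rightarrow> complex^'m"
  assumes "(f has_derivative f') (at (x + t *s v))" "\<And>c v. f' (c *s v) = c *s f' v"
  shows "((\<lambda>t. f (x + t *s v) $ i) has_field_derivative f' v $ i) (at t)"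
proof -
  have "bounded_linear (\<lambda>h. h *s v)"
  proof (rule bounded_linear_intro[where K = "norm v"])
  qed (auto simp: norm_vector_smult scaleR_eq_smult vector_sadd_rdistrib scaleR_conv_of_real)
  then have "((\<lambda>t. x + t *s v) has_derivative (\<lambda>h. h *s v)) (at t)"
    using has_derivative_add[OF has_derivative_const bounded_linear_imp_has_derivative] by force
  then have "((\<lambda>t. f (x + t *s v)) has_derivative (\<lambda>h. f' (h *s v))) (at t)"
    using assms(1) diff_chain_at[of "\<lambda>t. x + t *s v" _ t f f'] by (simp add: o_def)
  then have "((\<lambda>t. f (x + t *s v) $ i) has_derivative (\<lambda>h. f' (h *s v) $ i)) (at t)"
    by (rule bounded_linear.has_derivative[OF bounded_linear_vec_nth])
  then show ?thesis
    by (simp add: has_field_derivative_def assms(2) mult_commute_abs)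
qed

lemma line_holomorphic_on:
  assumes "open S" "holomorphic_map_on f S" "\<And>t. t \<in> T \<Longrightarrow> x + t *s v \<in> S"
  shows "(\<lambda>t. f (x + t *s v) $ i) holomorphic_on T"
proof (rule holomorphic_onI)
  fix t assume "t \<in> T"
  then have "x + t *s v \<in> S"
    by (rule assms(3))
  then obtain f' where "(f has_derivative f') (at (x + t *s v))" "\<forall>c v. f' (c *s v) = c *s f' v"
    using assms(1,2) unfolding holomorphic_map_on_def by (metis at_within_open)
  then have "((\<lambda>t. f (x + t *s v) $ i) has_field_derivative f' v $ i) (at t)"
    by (intro line_has_field_derivative) auto
  then show "(\<lambda>t. f (x + t *s v) $ i) field_differentiable at t within T"
    using field_differentiable_at_within field_differentiable_def by blast
qed

text \<open>Complex linearity determines \<open>f'\<close> by its values on the vectors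
  \<open>axis k 1\<close>, and these are the derivatives along the coordinate lines.\<close>

lemma complex_jacobian_eqI:
  assumes "(f has_derivative f') (at x)" "\<And>c v. f' (c *s v) = c *s f' v"
  shows "f' = (\<lambda>v. complex_jacobian f x *v v)"
proof -
  have *: "complex_jacobian f x $ i $ k = f' (axis k 1) $ i" for i k
    using line_has_field_derivative[of f f' x 0 "axis k 1" i] assms
    by (simp add: complex_jacobian_def DERIV_imp_deriv)
  have **: "f' v = (\<Sum>k\<in>UNIV. v $ k *s f' (axis k 1))" for v
  proof -
    have "f' v = f' (\<Sum>k\<in>UNIV. v $ k *s axis k 1)"
      by (simp add: basis_expansion)
    also have "\<dots> = (\<Sum>k\<in>UNIV. f' (v $ k *s axis k 1))"
      using assms(1) by (simp add: has_derivative_linear linear_sum)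
    finally show ?thesis
      by (simp add: assms(2))
  qed
  show ?thesis
  proof
    fix v
    show "f' v = complex_jacobian f x *v v"
      by (subst **) (simp add: vec_eq_iff matrix_vector_mult_def * mult.commute)
  qed
qed

lemma has_derivative_complex_jacobian:
  assumes "open S" "holomorphic_map_on f S" "x \<in> S"
  shows "(f has_derivative (\<lambda>v. complex_jacobian f x *v v)) (at x)"
proof -
  obtain f' where "(f has_derivative f') (at x)" "\<forall>c v. f' (c *s v) = c *s f' v"
    using assms unfolding holomorphic_map_on_def by (metis at_within_open)
  then show ?thesis
    using complex_jacobian_eqI[of f f' x] by metis
qed

section \<open>Cauchy estimates and uniform limits of holomorphic maps\<close>

text \<open>Cauchy's inequality for the difference of the restrictions to the \<open>k\<close>-th
  coordinate line, on the circle of radius \<open>r\<close>. The larger radius \<open>r'\<close>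
  supplies continuity up to that circle.\<close>

lemma norm_complex_jacobian_diff_le:
  fixes f g :: "complex^'n \<Rightarrow> complex^'m"
  assumes "(\<lambda>t. f (x + t *s axis k 1) $ i) holomorphic_on ball 0 r'"
      and "(\<lambda>t. g (x + t *s axis k 1) $ i) holomorphic_on ball 0 r'"
      and "0 < r" "r < r'" "\<And>y. norm (y - x) = r \<Longrightarrow> norm (f y - g y) \<le> B"
  shows "norm (complex_jacobian f x $ i $ k - complex_jacobian g x $ i $ k) \<le> B / r"
proof -
  let ?h = "\<lambda>t. f (x + t *s axis k 1) $ i - g (x + t *s axis k 1) $ i"
  have h: "?h holomorphic_on ball 0 r'"
    by (intro holomorphic_intros assms)
  have "norm ((deriv ^^ 1) ?h 0) \<le> fact 1 * B / r ^ 1"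
  proof (rule Cauchy_inequality)
    show "?h holomorphic_on ball 0 r" "continuous_on (cball 0 r) ?h"
      using h \<open>r < r'\<close>
      by (auto intro!: holomorphic_on_subset[OF h] continuous_on_subset[OF holomorphic_on_imp_continuous_on[OF h]])
    show "norm (?h t) \<le> B" if "norm (0 - t) = r" for t
    proof -
      have "norm (f (x + t *s axis k 1) - g (x + t *s axis k 1)) \<le> B"
        using that by (intro assms(5)) (simp add: norm_vector_smult)
      then show ?thesis
        using order_trans[OF Finite_Cartesian_Product.norm_nth_le] by fastforce
    qed
  qed fact
  moreover have "deriv ?h 0 = complex_jacobian f x $ i $ k - complex_jacobian g x $ i $ k"
    unfolding complex_jacobian_def using assms(1-4)
    by (subst deriv_diff) (auto intro!: holomorphic_on_imp_differentiable_at)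
  ultimately show ?thesis
    by simp
qed

text \<open>Weierstrass' theorem. Cauchy estimates on circles of radius \<open>R/4\<close> make the
  Jacobian entries converge uniformly on the half ball; the theorem on differentiating sequences
  then identifies the derivative of the limit.\<close>

lemma holomorphic_map_uniform_limit:
  fixes f :: "nat \<Rightarrow> complex^'n \<Rightarrow> complex^'m"
  assumes ev: "\<forall>\<^sub>F j in sequentially. holomorphic_map_on (f j) (ball z R)"
      and lim: "uniform_limit (ball z R) f g sequentially" and "0 < R"
  shows "holomorphic_map_on g (ball z (R/2))"
    and "uniform_limit (ball z (R/2)) (\<lambda>j x. complex_jacobian (f j) x $ i $ k)
           (\<lambda>x. complex_jacobian g x $ i $ k) sequentially"
proof -
  have in_ball: "x + t *s axis l 1 \<in> ball z R" if "x \<in> ball z (R/2)" "t \<in> ball 0 (R/2)" for x t l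
  proof -
    have "dist z (x + t *s axis l 1) \<le> dist z x + norm (t *s axis l (1::complex))"
      by (metis dist_norm dist_triangle add_diff_cancel_left' dist_commute)
    then show ?thesis
      using that by (simp add: norm_vector_smult)
  qed
  have hol_f: "(\<lambda>t. f j (x + t *s axis l 1) $ m) holomorphic_on ball 0 (R/2)"
    if "holomorphic_map_on (f j) (ball z R)" "x \<in> ball z (R/2)" for j x l m
    by (rule line_holomorphic_on[OF open_ball that(1)]) (use that in_ball in auto)
  \<comment> \<open>Differentiability of \<open>g\<close> is still open here. One-variable
    Weierstrass gives holomorphy along coordinate lines, which is what the Cauchy estimate for
    \<open>complex_jacobian g\<close> asks. The shift by \<open>N\<close> drops the maps that may
    fail to be holomorphic on the ball.\<close>
  have hol_g: "(\<lambda>t. g (x + t *s axis l 1) $ m) holomorphic_on ball 0 (R/2)"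
    if x: "x \<in> ball z (R/2)" for x l m
  proof -
    obtain N where N: "\<And>j. j \<ge> N \<Longrightarrow> holomorphic_map_on (f j) (ball z R)"
      using ev by (auto simp: eventually_sequentially)
    show ?thesis
    proof (rule holomorphic_uniform_sequence[where f = "\<lambda>j t. f (j + N) (x + t *s axis l 1) $ m"])
      show "(\<lambda>t. f (j + N) (x + t *s axis l 1) $ m) holomorphic_on ball 0 (R/2)" for j
        by (rule hol_f[OF N x]) simp
      have "uniform_limit (ball 0 (R/2)) (\<lambda>j t. f (j + N) (x + t *s axis l 1) $ m)
              (\<lambda>t. g (x + t *s axis l 1) $ m) sequentially"
        unfolding uniform_limit_iff
      proof (intro allI impI)
        fix e :: real assume "e > 0"
        then have "\<forall>\<^sub>F j in sequentially. \<forall>y\<in>ball z R. dist (f (j + N) y) (g y) < e"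
          using lim unfolding uniform_limit_iff by (intro sequentially_offset) auto
        then show "\<forall>\<^sub>F j in sequentially. \<forall>t\<in>ball 0 (R/2).
            dist (f (j + N) (x + t *s axis l 1) $ m) (g (x + t *s axis l 1) $ m) < e"
          by eventually_elim (meson dist_vec_nth_le in_ball[OF x] le_less_trans)
      qed
      then show "\<exists>d>0. cball t d \<subseteq> ball 0 (R/2) \<and> uniform_limit (cball t d)
          (\<lambda>j t. f (j + N) (x + t *s axis l 1) $ m) (\<lambda>t. g (x + t *s axis l 1) $ m) sequentially"
        if "t \<in> ball 0 (R/2)" for t
        using that open_contains_cball[of "ball (0::complex) (R/2)"] by (meson open_ball uniform_limit_on_subset)
    qed auto
  qed
  have ulim: "\<forall>\<^sub>F j in sequentially. \<forall>x\<in>ball z (R/2). \<forall>m l.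
      norm (complex_jacobian (f j) x $ m $ l - complex_jacobian g x $ m $ l) \<le> e" if "e > 0" for e
  proof -
    have "\<forall>\<^sub>F j in sequentially. \<forall>y\<in>ball z R. dist (f j y) (g y) < e * (R/4)"
      using lim[unfolded uniform_limit_iff, rule_format, of "e * (R/4)"] \<open>e > 0\<close> \<open>0 < R\<close> by simp
    with ev show ?thesis
    proof eventually_elim
      case (elim j)
      show ?case
      proof (intro ballI allI)
        fix x m l assume x: "x \<in> ball z (R/2)"
        have "norm (complex_jacobian (f j) x $ m $ l - complex_jacobian g x $ m $ l) \<le> (e * (R/4)) / (R/4)"
        proof (rule norm_complex_jacobian_diff_le[OF hol_f[OF elim(1) x] hol_g[OF x]])
          fix y assume "norm (y - x) = R/4"
          then have "y \<in> ball z R"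
            using x \<open>0 < R\<close> dist_triangle[of z y x] by (simp add: dist_norm norm_minus_commute)
          then show "norm (f j y - g y) \<le> e * (R/4)"
            using elim(2) by (auto simp: dist_norm intro: less_imp_le)
        qed (use \<open>0 < R\<close> in auto)
        then show "norm (complex_jacobian (f j) x $ m $ l - complex_jacobian g x $ m $ l) \<le> e"
          using \<open>0 < R\<close> by simp
      qed
    qed
  qed
  show "uniform_limit (ball z (R/2)) (\<lambda>j x. complex_jacobian (f j) x $ i $ k)
           (\<lambda>x. complex_jacobian g x $ i $ k) sequentially"
    unfolding uniform_limit_iff dist_norm
  proof (intro allI impI)
    fix e :: real assume "e > 0"
    then have e: "e / 2 > 0" "e / 2 < e" by auto
    from ulim[OF e(1)] show "\<forall>\<^sub>F j in sequentially. \<forall>x\<in>ball z (R/2).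
        norm (complex_jacobian (f j) x $ i $ k - complex_jacobian g x $ i $ k) < e"
      by eventually_elim (blast intro: le_less_trans[OF _ e(2)])
  qed
  obtain N where N: "\<And>j. j \<ge> N \<Longrightarrow> holomorphic_map_on (f j) (ball z R)"
    using ev by (auto simp: eventually_sequentially)
  have lim_at: "(\<lambda>j. f (j + N) x) \<longlonglongrightarrow> g x" if "x \<in> ball z (R/2)" for x
    using that \<open>0 < R\<close> by (intro LIMSEQ_ignore_initial_segment tendsto_uniform_limitI[OF lim]) auto
  \<comment> \<open>The theorem supplies some limit \<open>g'\<close> with the right derivative. It
    agrees with \<open>g\<close> on the half ball by uniqueness of pointwise limits, so the
    derivative carries over.\<close>
  have "\<exists>g'. \<forall>x\<in>ball z (R/2). (\<lambda>j. f (j + N) x) \<longlonglongrightarrow> g' x \<and>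
      (g' has_derivative (\<lambda>v. complex_jacobian g x *v v)) (at x within ball z (R/2))"
  proof (rule has_derivative_sequence)
    show "(f (j + N) has_derivative (\<lambda>v. complex_jacobian (f (j + N)) x *v v)) (at x within ball z (R/2))"
      if "x \<in> ball z (R/2)" for j x
      using has_derivative_complex_jacobian[OF open_ball N[of "j + N"], of x] that \<open>0 < R\<close>
      by (auto intro: has_derivative_at_withinI)
    show "\<forall>\<^sub>F j in sequentially. \<forall>x\<in>ball z (R/2). \<forall>v.
        norm (complex_jacobian (f (j + N)) x *v v - complex_jacobian g x *v v) \<le> e * norm v" if "e > 0" for e
    proof -
      define c where "c = real CARD('m) * real CARD('n)"
      have "c > 0" by (simp add: c_def)
      have "\<forall>\<^sub>F j in sequentially. \<forall>x\<in>ball z (R/2). \<forall>m l.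
          norm (complex_jacobian (f (j + N)) x $ m $ l - complex_jacobian g x $ m $ l) \<le> e / c"
        using ulim[of "e / c"] \<open>e > 0\<close> \<open>c > 0\<close> by (subst eventually_sequentially_seg[where k = N]) simp
      then show ?thesis
      proof eventually_elim
        case (elim j)
        show ?case
        proof (intro ballI allI)
          fix x v assume "x \<in> ball z (R/2)"
          then have "norm ((complex_jacobian (f (j + N)) x - complex_jacobian g x) *v v) \<le> c * (e / c) * norm v"
            unfolding c_def using elim unfolding c_def
            by (intro norm_matrix_vector_mult_le) simp
          then show "norm (complex_jacobian (f (j + N)) x *v v - complex_jacobian g x *v v) \<le> e * norm v"
            using \<open>c > 0\<close> by (simp add: matrix_vector_mult_diff_rdistrib)
        qed
      qed
    qed
    show "z \<in> ball z (R/2)"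
      using \<open>0 < R\<close> by simp
    then show "(\<lambda>j. f (j + N) z) \<longlonglongrightarrow> g z"
      by (rule lim_at)
  qed simp
  then obtain g' where g': "\<And>x. x \<in> ball z (R/2) \<Longrightarrow> (\<lambda>j. f (j + N) x) \<longlonglongrightarrow> g' x"
      "\<And>x. x \<in> ball z (R/2) \<Longrightarrow> (g' has_derivative (\<lambda>v. complex_jacobian g x *v v)) (at x within ball z (R/2))"
    by blast
  have "g' x = g x" if "x \<in> ball z (R/2)" for x
    using lim_at[OF that] g'(1)[OF that] by (rule LIMSEQ_unique[symmetric])
  then show "holomorphic_map_on g (ball z (R/2))"
    by (intro holomorphic_map_onI[where M = "complex_jacobian g"] has_derivative_transform[OF _ _ g'(2)]) auto
qed

section \<open>Holomorphy of the Jacobian entries\<close>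

lemma bounded_linear_smult_right: "bounded_linear (\<lambda>v. c *s (v :: complex^'n))"
  by (rule bounded_linear_intro[where K = "norm c"])
    (auto simp: vector_add_ldistrib norm_vector_smult scaleR_eq_smult mult.commute)

lemma holomorphic_map_on_locally:
  assumes "\<And>x. x \<in> S \<Longrightarrow> \<exists>r>0. holomorphic_map_on f (ball x r)"
  shows "holomorphic_map_on f S"
  unfolding holomorphic_map_on_def
proof
  fix x assume "x \<in> S"
  then obtain r where r: "r > 0" "holomorphic_map_on f (ball x r)"
    using assms by blast
  then obtain f' where "(f has_derivative f') (at x)" "\<forall>c v. f' (c *s v) = c *s f' v"
    unfolding holomorphic_map_on_def by (metis at_within_open centre_in_ball open_ball)
  then show "\<exists>f'. (f has_derivative f') (at x within S) \<and> (\<forall>c v. f' (c *s v) = c *s f' v)"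
    using has_derivative_at_withinI by blast
qed

text \<open>By the Taylor estimate the difference quotients converge locally uniformly, so the
  theorem on uniform limits applies.\<close>

lemma complex_jacobian_column_holomorphic:
  fixes f :: "complex^'n \<Rightarrow> complex^'m"
  assumes "open S" "holomorphic_map_on f S"
  shows "holomorphic_map_on (\<lambda>x. \<chi> i. complex_jacobian f x $ i $ k) S"
proof (rule holomorphic_map_on_locally)
  fix x0 assume "x0 \<in> S"
  then obtain R where R: "R > 0" "cball x0 R \<subseteq> S"
    using \<open>open S\<close> open_contains_cball by blast
  \<comment> \<open>Base points and increments each get half of the radius, so that their sums stay
    in \<open>cball x0 R\<close>, where \<open>f\<close> is bounded.\<close>
  define r where "r = R/2"
  have "r > 0" using R by (simp add: r_def)
  have "bounded (f ` cball x0 R)"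
    using compact_imp_bounded compact_continuous_image compact_cball continuous_on_subset
      holomorphic_map_on_imp_continuous_on[OF assms(2)] R(2) by metis
  then obtain B where B: "\<And>y. y \<in> cball x0 R \<Longrightarrow> norm (f y) \<le> B"
    unfolding bounded_iff by blast
  \<comment> \<open>Cauchy's bound for a second derivative along a line: a disc of radius
    \<open>r/3\<close> about a point of \<open>ball 0 (r/2)\<close> still lies in
    \<open>ball 0 r\<close>.\<close>
  define C where "C = 2 * B / (r/3)\<^sup>2"
  have near: "x + t *s axis k 1 \<in> cball x0 R" if "x \<in> ball x0 r" "t \<in> ball 0 r" for x t
  proof -
    have "dist x0 (x + t *s axis k 1) \<le> dist x0 x + norm (t *s axis k (1::complex))"
      by (metis dist_norm dist_triangle add_diff_cancel_left' dist_commute)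
    then show ?thesis
      using that by (simp add: norm_vector_smult r_def)
  qed
  have taylor: "norm (f (x + s *s axis k 1) $ i - f x $ i - complex_jacobian f x $ i $ k * s) \<le> C * (norm s)\<^sup>2"
    if x: "x \<in> ball x0 r" and s: "s \<in> ball 0 (r/2)" for x s i
  proof -
    define \<phi> where "\<phi> = (\<lambda>t. f (x + t *s axis k 1) $ i)"
    have hol: "\<phi> holomorphic_on ball 0 r"
      unfolding \<phi>_def by (rule line_holomorphic_on[OF assms]) (use near x R(2) in blast)
    have "norm ((deriv ^^ 0) \<phi> s - (\<Sum>l\<le>1. (deriv ^^ l) \<phi> 0 * (s - 0) ^ l / fact l))
        \<le> C * norm (s - 0) ^ Suc 1 / fact 1"
    proof (rule complex_Taylor[where S = "ball 0 (r/2)"])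
      fix l y assume y: "y \<in> ball (0::complex) (r/2)"
      have "(deriv ^^ l) \<phi> holomorphic_on ball 0 r"
        by (rule holomorphic_higher_deriv[OF hol open_ball])
      then have "((deriv ^^ l) \<phi> has_field_derivative deriv ((deriv ^^ l) \<phi>) y) (at y)"
        by (rule holomorphic_derivI) (use y \<open>r > 0\<close> in auto)
      then show "((deriv ^^ l) \<phi> has_field_derivative (deriv ^^ Suc l) \<phi> y) (at y within ball 0 (r/2))"
        by (simp add: has_field_derivative_at_within)
    next
      fix y assume y: "y \<in> ball (0::complex) (r/2)"
      have sub: "cball y (r/3) \<subseteq> ball 0 r"
      proof
        fix w assume "w \<in> cball y (r/3)"
        then show "w \<in> ball 0 r"
          using y dist_triangle[of 0 w y] \<open>r > 0\<close> by auto
      qed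
      have "norm ((deriv ^^ 2) \<phi> y) \<le> fact 2 * B / (r/3) ^ 2"
      proof (rule Cauchy_inequality)
        show "\<phi> holomorphic_on ball y (r/3)" "continuous_on (cball y (r/3)) \<phi>"
          using sub ball_subset_cball by (auto intro!: holomorphic_on_subset[OF hol]
              continuous_on_subset[OF holomorphic_on_imp_continuous_on[OF hol]])
        show "norm (\<phi> w) \<le> B" if "norm (y - w) = r/3" for w
        proof -
          have "w \<in> ball 0 r"
            using sub that by (auto simp: dist_norm)
          then show ?thesis
            using order_trans[OF Finite_Cartesian_Product.norm_nth_le B[OF near[OF x]]] by (simp add: \<phi>_def)
        qed
      qed (use \<open>r > 0\<close> in auto)
      then show "norm ((deriv ^^ Suc 1) \<phi> y) \<le> C"
        by (simp add: C_def numeral_2_eq_2)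
    qed (use s \<open>r > 0\<close> in auto)
    moreover have "deriv \<phi> 0 = complex_jacobian f x $ i $ k"
      by (simp add: complex_jacobian_def \<phi>_def)
    ultimately show ?thesis
      by (simp add: \<phi>_def power2_eq_square diff_diff_eq)
  qed
  \<comment> \<open>Nonzero increments tending to 0. With \<open>m + 2\<close> the norm is strictly
    below \<open>r/2\<close>, as \<open>taylor\<close> demands, already for
    \<open>m = 0\<close>.\<close>
  define s where "s = (\<lambda>m. complex_of_real (r / 2 / real (m + 2)))"
  have norm_s: "norm (s m) = r / 2 / real (m + 2)" for m
    using \<open>r > 0\<close> unfolding s_def norm_of_real by simp
  have s: "s m \<in> ball 0 (r/2)" "s m \<noteq> 0" for m
  proof -
    have "0 < norm (s m)" "norm (s m) < r/2"
      using \<open>r > 0\<close> by (simp_all add: norm_s field_simps add_pos_nonneg)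
    then show "s m \<in> ball 0 (r/2)" "s m \<noteq> 0"
      by auto
  qed
  define Q where "Q = (\<lambda>m x. (1 / s m) *s (f (x + s m *s axis k 1) - f x))"
  have "holomorphic_map_on (\<lambda>x. \<chi> i. complex_jacobian f x $ i $ k) (ball x0 (r/2))"
  proof (rule holomorphic_map_uniform_limit(1)[where f = Q])
    show "\<forall>\<^sub>F m in sequentially. holomorphic_map_on (Q m) (ball x0 r)"
    proof (intro always_eventually allI)
      fix m
      show "holomorphic_map_on (Q m) (ball x0 r)"
        unfolding holomorphic_map_on_def
      proof
        fix x assume x: "x \<in> ball x0 r"
        define y where "y = x + s m *s axis k 1"
        have "y \<in> S" "x \<in> S"
          using near[OF x, of "s m"] near[OF x, of 0] s(1)[of m] \<open>r > 0\<close> R(2) by (auto simp: y_def)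
        then have dy: "(f has_derivative (\<lambda>v. complex_jacobian f y *v v)) (at y)"
           and dx: "(f has_derivative (\<lambda>v. complex_jacobian f x *v v)) (at x)"
          using assms has_derivative_complex_jacobian by blast+
        have "((\<lambda>x. x + s m *s axis k 1) has_derivative (\<lambda>v. v)) (at x)"
          by (auto intro!: derivative_eq_intros)
        from has_derivative_compose[OF this] dy
        have "((\<lambda>x. f (x + s m *s axis k 1)) has_derivative (\<lambda>v. complex_jacobian f y *v v)) (at x)"
          unfolding y_def by blast
        then have dQ: "(Q m has_derivative (\<lambda>v. (1 / s m) *s (complex_jacobian f y *v v - complex_jacobian f x *v v))) (at x)"
          unfolding Q_def
          by (intro bounded_linear.has_derivative[OF bounded_linear_smult_right] has_derivative_diff dx)
        show "\<exists>Q'. (Q m has_derivative Q') (at x within ball x0 r) \<and> (\<forall>c v. Q' (c *s v) = c *s Q' v)"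
        proof (intro exI conjI allI)
          show "(1 / s m) *s (complex_jacobian f y *v (c *s v) - complex_jacobian f x *v (c *s v)) =
              c *s ((1 / s m) *s (complex_jacobian f y *v v - complex_jacobian f x *v v))" for c v
            by (simp add: vec.linear_scale[OF matrix_vector_mul_linear_gen] vec_eq_iff algebra_simps)
        qed (rule has_derivative_at_withinI[OF dQ])
      qed
    qed
    show "uniform_limit (ball x0 r) Q (\<lambda>x. \<chi> i. complex_jacobian f x $ i $ k) sequentially"
    proof (rule uniform_limitI)
      fix e :: real assume "e > 0"
      have "(\<lambda>m. real CARD('m) * (C * (r / 2 / real (m + 2)))) \<longlonglongrightarrow> real CARD('m) * (C * 0)"
        by (intro tendsto_intros) real_asymp
      then have "\<forall>\<^sub>F m in sequentially. real CARD('m) * (C * (r / 2 / real (m + 2))) < e"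
        using \<open>e > 0\<close> by (simp add: order_tendstoD)
      then show "\<forall>\<^sub>F m in sequentially. \<forall>x\<in>ball x0 r. dist (Q m x) (\<chi> i. complex_jacobian f x $ i $ k) < e"
      proof eventually_elim
        case (elim m)
        show ?case
        proof
          fix x assume x: "x \<in> ball x0 r"
          let ?d = "Q m x - (\<chi> i. complex_jacobian f x $ i $ k)"
          have "norm (?d $ i) \<le> C * norm (s m)" for i
          proof -
            have "?d $ i = (f (x + s m *s axis k 1) $ i - f x $ i - complex_jacobian f x $ i $ k * s m) / s m"
              using s(2)[of m] by (simp add: Q_def field_simps)
            then have "norm (?d $ i) \<le> C * (norm (s m))\<^sup>2 / norm (s m)"
              using taylor[OF x s(1)] by (simp only: norm_divide) (intro divide_right_mono, auto)
            then show ?thesis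
              using s(2)[of m] by (simp add: power2_eq_square)
          qed
          then have "(\<Sum>i\<in>UNIV. norm (?d $ i)) \<le> (\<Sum>i\<in>(UNIV :: 'm set). C * norm (s m))"
            by (intro sum_mono)
          moreover have "norm ?d \<le> (\<Sum>i\<in>UNIV. norm (?d $ i))"
            unfolding norm_vec_def by (rule L2_set_le_sum) simp
          ultimately show "dist (Q m x) (\<chi> i. complex_jacobian f x $ i $ k) < e"
            using elim by (simp add: dist_norm norm_s)
        qed
      qed
    qed
  qed fact
  then show "\<exists>r>0. holomorphic_map_on (\<lambda>x. \<chi> i. complex_jacobian f x $ i $ k) (ball x0 r)"
    using \<open>r > 0\<close> half_gt_zero by blast
qed

text \<open>The determinant is a polynomial in entries that are holomorphic along lines. This
  reduces questions about its zeros to one variable.\<close>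

lemma det_complex_jacobian_line_holomorphic:
  fixes f :: "complex^'n \<Rightarrow> complex^'n"
  assumes "open S" "holomorphic_map_on f S" "\<And>t. t \<in> T \<Longrightarrow> x + t *s v \<in> S"
  shows "(\<lambda>t. det (complex_jacobian f (x + t *s v))) holomorphic_on T"
proof -
  have "(\<lambda>t. complex_jacobian f (x + t *s v) $ i $ k) holomorphic_on T" for i k
    using line_holomorphic_on[OF assms(1) complex_jacobian_column_holomorphic[OF assms(1,2), of k] assms(3), of T i]
    by simp
  then show ?thesis
    unfolding det_def by (intro holomorphic_intros)
qed

lemma continuous_on_det_complex_jacobian:
  fixes f :: "complex^'n \<Rightarrow> complex^'n"
  assumes "open S" "holomorphic_map_on f S"
  shows "continuous_on S (\<lambda>x. det (complex_jacobian f x))"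
proof -
  have "continuous_on S (\<lambda>x. complex_jacobian f x $ i $ k)" for i k
    using continuous_on_component[OF holomorphic_map_on_imp_continuous_on[OF
          complex_jacobian_column_holomorphic[OF assms]], of k i]
    by simp
  then show ?thesis
    unfolding det_def by (intro continuous_on_sum continuous_on_mult continuous_on_const continuous_on_prod)
qed

section \<open>Nonvanishing Jacobian determinants under uniform limits\<close>

lemma uniform_limit_sum:
  fixes f :: "'i \<Rightarrow> 'a \<Rightarrow> 'b \<Rightarrow> 'c::real_normed_vector"
  assumes "\<And>i. i \<in> I \<Longrightarrow> uniform_limit K (f i) (g i) F"
  shows "uniform_limit K (\<lambda>a x. \<Sum>i\<in>I. f i a x) (\<lambda>x. \<Sum>i\<in>I. g i x) F"
  using assms
  by (induction I rule: infinite_finite_induct) (auto intro!: uniform_limit_add uniform_limit_const)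

text \<open>Uniform convergence passes to a product when the limits are bounded, so boundedness of
  the partial products is carried through the induction.\<close>

lemma uniform_limit_prod:
  fixes f :: "'i \<Rightarrow> 'a \<Rightarrow> 'b \<Rightarrow> complex"
  assumes "\<And>i. i \<in> I \<Longrightarrow> uniform_limit K (f i) (g i) F" "\<And>i. i \<in> I \<Longrightarrow> bounded (g i ` K)"
  shows "uniform_limit K (\<lambda>a x. \<Prod>i\<in>I. f i a x) (\<lambda>x. \<Prod>i\<in>I. g i x) F
    \<and> bounded ((\<lambda>x. \<Prod>i\<in>I. g i x) ` K)"
  using assms
proof (induction I rule: infinite_finite_induct)
  case (insert i I)
  have "bounded (g i ` K)" "bounded ((\<lambda>x. \<Prod>i\<in>I. g i x) ` K)"
    using insert by auto
  then obtain a b where "\<And>x. x \<in> K \<Longrightarrow> norm (g i x) \<le> a" "\<And>x. x \<in> K \<Longrightarrow> norm (\<Prod>i\<in>I. g i x) \<le> b"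
    unfolding bounded_iff by blast
  then have "norm (g i x * (\<Prod>i\<in>I. g i x)) \<le> a * b" if "x \<in> K" for x
    using that unfolding norm_mult by (meson mult_mono' norm_ge_zero)
  then have "bounded ((\<lambda>x. g i x * (\<Prod>i\<in>I. g i x)) ` K)"
    by (auto simp: bounded_iff)
  then show ?case
    using insert by (auto intro!: uniform_lim_mult)
qed (auto simp: uniform_limit_const image_constant_conv)

text \<open>The chain rule gives \<open>B ** A = mat 1\<close>. This serves for biholomorphic maps
  and also for limits known to be inverse only near one point.\<close>

lemma det_complex_jacobian_left_inverse:
  fixes f h :: "complex^'n \<Rightarrow> complex^'n"
  assumes "(f has_derivative (\<lambda>v. A *v v)) (at x)" "(h has_derivative (\<lambda>v. B *v v)) (at (f x))"
    and "open U" "x \<in> U" "\<And>y. y \<in> U \<Longrightarrow> h (f y) = y"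
  shows "det A \<noteq> 0" "det B \<noteq> 0"
proof -
  have "((\<lambda>y. h (f y)) has_derivative (\<lambda>v. B *v (A *v v))) (at x)"
    by (rule has_derivative_compose[OF assms(1,2)])
  then have "((\<lambda>y. y) has_derivative (\<lambda>v. B *v (A *v v))) (at x)"
    by (rule has_derivative_transform_within_open[OF _ assms(3,4,5)])
  then have "(\<lambda>v. B *v (A *v v)) = (\<lambda>v. v)"
    by (rule has_derivative_unique) (rule has_derivative_ident)
  then have "(B ** A) *v v = mat 1 *v v" for v
    by (simp add: matrix_vector_mul_assoc[symmetric] fun_eq_iff)
  then have "B ** A = mat 1"
    using matrix_eq by blast
  then have "det B * det A = 1"
    by (metis det_I det_mul)
  then show "det A \<noteq> 0" "det B \<noteq> 0"
    by auto
qed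

text \<open>A preimage of \<open>w\<close> is a Brouwer fixed point of the Newton map
  \<open>y \<mapsto> y - M\<^sup>-\<^sup>1 (f j y - w)\<close>.\<close>

lemma uniform_open_mapping:
  fixes f :: "nat \<Rightarrow> complex^'n \<Rightarrow> complex^'n"
  assumes "(g has_derivative (\<lambda>v. M *v v)) (at z)" "det M \<noteq> 0" "0 < R"
    and lim: "uniform_limit (ball z R) f g F"
    and cont: "\<forall>\<^sub>F j in F. continuous_on (ball z R) (f j)"
  obtains e where "0 < e" "\<forall>\<^sub>F j in F. ball (g z) e \<subseteq> f j ` ball z R"
proof -
  obtain N where N: "N ** M = mat 1" "M ** N = mat 1"
    using \<open>det M \<noteq> 0\<close> by (metis invertible_def invertible_det_nz)
  have "bounded_linear (\<lambda>v. N *v v)"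
    by (rule matrix_vector_mul_bounded_linear)
  then obtain c where "c > 0" and c: "\<And>v. norm (N *v v) \<le> norm v * c"
    using bounded_linear.pos_bounded by blast
  have "\<exists>d>0. \<forall>y. norm (y - z) < d \<longrightarrow> norm (g y - g z - M *v (y - z)) \<le> 1 / (4 * c) * norm (y - z)"
    using conjunct2[OF assms(1)[unfolded has_derivative_at_alt], rule_format, of "1 / (4 * c)"] \<open>c > 0\<close>
    by simp
  then obtain d where "d > 0" and
    d: "\<And>y. norm (y - z) < d \<Longrightarrow> norm (g y - g z - M *v (y - z)) \<le> 1 / (4 * c) * norm (y - z)"
    by blast
  define \<rho> where "\<rho> = min d R / 2"
  have \<rho>: "0 < \<rho>" "\<rho> < d" "\<rho> < R"
    using \<open>d > 0\<close> \<open>R > 0\<close> by (auto simp: \<rho>_def)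
  \<comment> \<open>Three errors of size at most \<open>e\<close> will occur; the constant
    \<open>1 / (4 * c)\<close> makes the remainder of the linearization one of them. Applying
    \<open>N\<close> costs a factor \<open>c\<close>, so the total is at most three quarters of
    \<open>\<rho>\<close>.\<close>
  define e where "e = \<rho> / (4 * c)"
  have "e > 0" using \<rho> \<open>c > 0\<close> by (simp add: e_def)
  have "\<forall>\<^sub>F j in F. \<forall>y\<in>ball z R. dist (f j y) (g y) < e"
    using lim \<open>e > 0\<close> by (simp add: uniform_limit_iff)
  with cont have "\<forall>\<^sub>F j in F. ball (g z) e \<subseteq> f j ` ball z R"
  proof eventually_elim
    case (elim j)
    show ?case
    proof
      fix w assume w: "w \<in> ball (g z) e"
      define T where "T = (\<lambda>y. y - N *v (f j y - w))"
      have sub: "cball z \<rho> \<subseteq> ball z R"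
        using \<rho> by auto
      have "T y \<in> cball z \<rho>" if y: "y \<in> cball z \<rho>" for y
      proof -
        \<comment> \<open>The linear part of \<open>N *v (f j y - w)\<close> cancels
          \<open>y - z\<close>. What is left is the distance from \<open>f j\<close> to
          \<open>g\<close>, the remainder of the linearization, and the distance from
          \<open>g z\<close> to \<open>w\<close>.\<close>
        let ?u = "(f j y - g y) + (g y - g z - M *v (y - z)) + (g z - w)"
        have NM: "N *v (M *v (y - z)) = y - z"
          by (simp add: matrix_vector_mul_assoc N)
        have u: "?u = (f j y - w) - M *v (y - z)"
          by simp
        have "z - T y = N *v ?u"
          unfolding u by (simp only: T_def matrix_vector_mult_diff_distrib[of N "f j y - w"] NM) simp
        moreover have "norm (f j y - g y) \<le> e"
          using elim(2) y sub by (metis dist_norm less_imp_le subsetD)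
        moreover have "norm (g y - g z - M *v (y - z)) \<le> e"
        proof -
          have "norm (y - z) \<le> \<rho>"
            using y by (simp add: dist_norm norm_minus_commute)
          moreover from this have "norm (g y - g z - M *v (y - z)) \<le> 1 / (4 * c) * norm (y - z)"
            using \<rho> by (intro d) simp
          ultimately show ?thesis
            using \<open>c > 0\<close> by (simp add: e_def divide_right_mono order_trans)
        qed
        moreover have "norm (g z - w) \<le> e"
          using w by (simp add: dist_norm)
        ultimately have "norm (z - T y) \<le> (e + e + e) * c"
          using c[of ?u] \<open>c > 0\<close>
          by (smt (verit) mult_right_mono norm_triangle_ineq)
        also have "\<dots> \<le> \<rho>"
          using \<open>c > 0\<close> \<rho> by (simp add: e_def field_simps)
        finally show ?thesis
          by (simp add: dist_norm)
      qed
      moreover have "continuous_on (cball z \<rho>) T"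
        unfolding T_def by (intro continuous_intros continuous_on_subset[OF elim(1) sub])
      ultimately obtain y where y: "y \<in> cball z \<rho>" "T y = y"
        using brouwer[of "cball z \<rho>" T] \<rho> by auto
      then have "M *v (N *v (f j y - w)) = M *v 0"
        by (simp add: T_def)
      then have "f j y = w"
        by (simp add: matrix_vector_mul_assoc N)
      then show "w \<in> f j ` ball z R"
        using y sub by blast
    qed
  qed
  then show ?thesis
    using that \<open>e > 0\<close> by blast
qed

text \<open>Hurwitz on complex lines through a zero shows that the zero set of the limit determinant
  is open.\<close>

lemma det_complex_jacobian_limit_nonzero:
  fixes f :: "nat \<Rightarrow> complex^'n \<Rightarrow> complex^'n"
  assumes "open W" "connected W"
    and loc: "\<And>z. z \<in> W \<Longrightarrow> \<exists>R>0. uniform_limit (ball z R) f g sequentially \<and>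
        (\<forall>\<^sub>F j in sequentially. holomorphic_map_on (f j) (ball z R) \<and>
           (\<forall>x\<in>ball z R. det (complex_jacobian (f j) x) \<noteq> 0))"
    and "a \<in> W" "det (complex_jacobian g a) \<noteq> 0" "z \<in> W"
  shows "det (complex_jacobian g z) \<noteq> 0"
proof -
  define B where "B = {x \<in> W. det (complex_jacobian g x) = 0}"
  have local_zero: "\<exists>R>0. \<forall>x\<in>ball z R. det (complex_jacobian g x) = 0"
    if z: "z \<in> W" "det (complex_jacobian g z) = 0" for z
  proof -
    obtain R where "R > 0" and lim: "uniform_limit (ball z R) f g sequentially"
      and ev: "\<forall>\<^sub>F j in sequentially. holomorphic_map_on (f j) (ball z R) \<and>
           (\<forall>x\<in>ball z R. det (complex_jacobian (f j) x) \<noteq> 0)"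
      using loc[OF z(1)] by blast
    obtain N where N: "\<And>j. j \<ge> N \<Longrightarrow> holomorphic_map_on (f j) (ball z R)"
      "\<And>j x. j \<ge> N \<Longrightarrow> x \<in> ball z R \<Longrightarrow> det (complex_jacobian (f j) x) \<noteq> 0"
      using ev unfolding eventually_sequentially by blast
    have ev': "\<forall>\<^sub>F j in sequentially. holomorphic_map_on (f j) (ball z R)"
      using ev by eventually_elim simp
    note hol_g = holomorphic_map_uniform_limit(1)[OF ev' lim \<open>R > 0\<close>]
    note lim_J = holomorphic_map_uniform_limit(2)[OF ev' lim \<open>R > 0\<close>]
    have "det (complex_jacobian g x) = 0" if x: "x \<in> ball z (R/2)" for x
    proof (rule ccontr)
      assume nz: "det (complex_jacobian g x) \<noteq> 0"
      \<comment> \<open>The complex line through the zero \<open>z\<close> and the supposed nonzero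
        point \<open>x\<close>: parameter 0 gives \<open>z\<close>, parameter 1 gives
        \<open>x\<close>, and on \<open>T\<close> the line stays in the half ball.\<close>
      define v where "v = x - z"
      have "v \<noteq> 0" using nz z(2) by (auto simp: v_def)
      define T where "T = ball (0::complex) (R / 2 / norm v)"
      have line: "z + t *s v \<in> ball z (R/2)" if "t \<in> T" for t
        using that \<open>v \<noteq> 0\<close> by (simp add: T_def dist_norm norm_vector_smult field_simps)
      have T: "0 \<in> T" "1 \<in> T"
        using \<open>R > 0\<close> \<open>v \<noteq> 0\<close> x by (auto simp: T_def v_def dist_norm norm_minus_commute field_simps)
      have hol_det_g: "(\<lambda>t. det (complex_jacobian g (z + t *s v))) holomorphic_on T"
        using det_complex_jacobian_line_holomorphic[OF open_ball hol_g line] .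
      \<comment> \<open>The approximants have no zeros on \<open>T\<close>, and the limit is not
        constant because it vanishes at 0 but not at 1. Hurwitz then forbids the zero at 0, a
        contradiction.\<close>
      have "det (complex_jacobian g (z + 0 *s v)) \<noteq> 0"
      proof (rule Hurwitz_no_zeros[where S = T and \<F> = "\<lambda>j t. det (complex_jacobian (f (j + N)) (z + t *s v))"
            and g = "\<lambda>t. det (complex_jacobian g (z + t *s v))"])
        show "(\<lambda>t. det (complex_jacobian (f (j + N)) (z + t *s v))) holomorphic_on T" for j
          using det_complex_jacobian_line_holomorphic[OF open_ball N(1)[of "j + N"], of T z v] line \<open>R > 0\<close>
          by force
        show "det (complex_jacobian (f (j + N)) (z + t *s v)) \<noteq> 0" if "t \<in> T" for j t
          using N(2)[of "j + N" "z + t *s v"] line[OF that] \<open>R > 0\<close> by auto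
        show "\<not> (\<lambda>t. det (complex_jacobian g (z + t *s v))) constant_on T"
          using nz z(2) T unfolding constant_on_def
          by (metis add_0_right add_diff_cancel_left' diff_add_cancel vector_smult_lid vector_smult_lzero v_def add.commute)
        show "uniform_limit K (\<lambda>j t. det (complex_jacobian (f (j + N)) (z + t *s v)))
            (\<lambda>t. det (complex_jacobian g (z + t *s v))) sequentially" if K: "compact K" "K \<subseteq> T" for K
        proof -
          have entry: "uniform_limit K (\<lambda>j t. complex_jacobian (f (j + N)) (z + t *s v) $ i $ k)
              (\<lambda>t. complex_jacobian g (z + t *s v) $ i $ k) sequentially" for i k
          proof -
            have "uniform_limit K (\<lambda>j t. complex_jacobian (f j) (z + t *s v) $ i $ k)
                (\<lambda>t. complex_jacobian g (z + t *s v) $ i $ k) sequentially"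
              by (rule uniform_limit_compose'[OF lim_J]) (use K line in auto)
            then show ?thesis
              by (rule filterlim_compose) (rule filterlim_add_const_nat_at_top)
          qed
          have bdd: "bounded ((\<lambda>t. complex_jacobian g (z + t *s v) $ i $ k) ` K)" for i k
          proof (intro compact_imp_bounded compact_continuous_image \<open>compact K\<close>)
            have "(\<lambda>t. (\<chi> i. complex_jacobian g (z + t *s v) $ i $ k) $ i) holomorphic_on T"
              by (rule line_holomorphic_on[OF open_ball complex_jacobian_column_holomorphic[OF open_ball hol_g] line])
            then show "continuous_on K (\<lambda>t. complex_jacobian g (z + t *s v) $ i $ k)"
              using K holomorphic_on_imp_continuous_on holomorphic_on_subset by fastforce
          qed
          show ?thesis
            unfolding det_def using entry bdd
            by (intro uniform_limit_sum bounded_linear.uniform_limit[OF bounded_linear_mult_right]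
                uniform_limit_prod[THEN conjunct1])
        qed
      qed (use T hol_det_g in \<open>auto simp: T_def\<close>)
      then show False
        using z(2) by simp
    qed
    then show ?thesis
      using \<open>R > 0\<close> half_gt_zero by blast
  qed
  \<comment> \<open>The zero set is open by \<open>local_zero\<close> and closed in \<open>W\<close>
    by continuity; connectedness and the point \<open>a\<close> make it empty.\<close>
  have "open B"
  proof (rule openI)
    fix x assume "x \<in> B"
    then obtain R e where "R > 0" "\<forall>y\<in>ball x R. det (complex_jacobian g y) = 0" "e > 0" "ball x e \<subseteq> W"
      using local_zero \<open>open W\<close> unfolding B_def open_contains_ball by blast
    then show "\<exists>e>0. ball x e \<subseteq> B"
      by (intro exI[of _ "min R e"]) (auto simp: B_def)
  qed
  moreover have "open (W - B)"
  proof -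
    have "holomorphic_map_on g W"
    proof (rule holomorphic_map_on_locally)
      fix z assume "z \<in> W"
      then obtain R where "R > 0" "uniform_limit (ball z R) f g sequentially"
        "\<forall>\<^sub>F j in sequentially. holomorphic_map_on (f j) (ball z R)"
        using loc by (smt (verit, best) eventually_mono)
      then show "\<exists>r>0. holomorphic_map_on g (ball z r)"
        using holomorphic_map_uniform_limit(1) half_gt_zero by blast
    qed
    then have "continuous_on W (\<lambda>x. det (complex_jacobian g x))"
      by (rule continuous_on_det_complex_jacobian[OF \<open>open W\<close>])
    moreover have "W - B = W \<inter> (\<lambda>x. det (complex_jacobian g x)) -` (- {0})"
      by (auto simp: B_def)
    ultimately show ?thesis
      using \<open>open W\<close> by (simp add: continuous_open_preimage open_Compl)
  qed
  moreover have "B \<subseteq> W"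
    by (auto simp: B_def)
  ultimately have "B = {} \<or> W - B = {}"
    using connectedD[OF \<open>connected W\<close>, of B "W - B"] by blast
  moreover have "a \<in> W - B"
    using assms by (auto simp: B_def)
  ultimately show ?thesis
    using \<open>z \<in> W\<close> by (auto simp: B_def)
qed

section \<open>Kernels and subsequences\<close>

text \<open>Allows the union over \<open>k\<close> in \<open>Ker\<close> to be formed before the
  component at the base point is taken.\<close>

definition eventual_interior :: "(nat \<Rightarrow> 'a::metric_space set) \<Rightarrow> 'a set" where
  "eventual_interior D = {x. \<exists>e>0. \<forall>\<^sub>F j in sequentially. ball x e \<subseteq> D j}"

lemma eventual_interior_eq: "eventual_interior D = (\<Union>k. interior (\<Inter>j\<in>{k..}. D j))"
proof -
  have "x \<in> eventual_interior D \<longleftrightarrow> (\<exists>e k. 0 < e \<and> ball x e \<subseteq> (\<Inter>j\<in>{k..}. D j))" for x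
    unfolding eventual_interior_def eventually_sequentially by (auto simp: le_INF_iff)
  then show ?thesis
    by (intro set_eqI) (simp only: UN_iff mem_interior, blast)
qed

lemma open_eventual_interior: "open (eventual_interior D)"
  unfolding eventual_interior_eq by blast

text \<open>The interiors increase with the index, so a finite subcover is contained in its last
  member.\<close>

lemma compact_subset_eventual_interior:
  assumes "compact K" "K \<subseteq> eventual_interior D"
  obtains k where "K \<subseteq> interior (\<Inter>j\<in>{k..}. D j)"
proof -
  obtain C where C: "finite C" "K \<subseteq> (\<Union>k\<in>C. interior (\<Inter>j\<in>{k..}. D j))"
    using compactE_image[OF assms(1), of UNIV "\<lambda>k. interior (\<Inter>j\<in>{k..}. D j)"] assms(2)
    unfolding eventual_interior_eq by auto
  have "interior (\<Inter>j\<in>{k..}. D j) \<subseteq> interior (\<Inter>j\<in>{Max C..}. D j)" if "k \<in> C" for k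
    using that C(1) by (intro interior_mono INF_superset_mono) auto
  then show ?thesis
    using C(2) that[of "Max C"] by blast
qed

text \<open>In an open set, points of a component are joined by paths, and the compact image of a
  path already lies in a single stage of the union.\<close>

lemma connected_component_eventual_interior:
  fixes D :: "nat \<Rightarrow> 'a::real_normed_vector set"
  shows "connected_component_set (eventual_interior D) p =
    (\<Union>k. connected_component_set (interior (\<Inter>j\<in>{k..}. D j)) p)"
proof (intro equalityI subsetI)
  fix x assume x: "x \<in> connected_component_set (eventual_interior D) p"
  then have "path_component (eventual_interior D) p x"
    by (simp add: path_component_eq_connected_component open_imp_locally_path_connected open_eventual_interior)
  then obtain \<gamma> where \<gamma>: "path \<gamma>" "path_image \<gamma> \<subseteq> eventual_interior D" "pathstart \<gamma> = p" "pathfinish \<gamma> = x"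
    unfolding path_component_def by blast
  then obtain k where "path_image \<gamma> \<subseteq> interior (\<Inter>j\<in>{k..}. D j)"
    using compact_subset_eventual_interior compact_path_image by blast
  then have "connected_component (interior (\<Inter>j\<in>{k..}. D j)) p x"
    unfolding connected_component_def using \<gamma> connected_path_image by blast
  then show "x \<in> (\<Union>k. connected_component_set (interior (\<Inter>j\<in>{k..}. D j)) p)"
    by blast
next
  fix x assume "x \<in> (\<Union>k. connected_component_set (interior (\<Inter>j\<in>{k..}. D j)) p)"
  then show "x \<in> connected_component_set (eventual_interior D) p"
    unfolding eventual_interior_eq
    by (metis (no_types, lifting) UN_E UNIV_I UN_upper connected_component_mono subsetD)
qed

lemma Ker_eq:
  fixes D :: "nat \<Rightarrow> 'a::real_normed_vector set"
  shows "Ker p_hat (\<lambda>j. (D j, p j)) = (connected_component_set (eventual_interior D) p_hat, p_hat)"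
  by (simp add: Ker_def connected_component_eventual_interior)

section \<open>Subsequences with a stable eventual interior\<close>

text \<open>Stability is demanded of the whole eventual interior, not of one component, so it
  implies Caratheodory convergence at every base point.\<close>

definition subseq_stable :: "(nat \<Rightarrow> 'a::metric_space set) \<Rightarrow> bool" where
  "subseq_stable D \<longleftrightarrow> (\<forall>s. strict_mono s \<longrightarrow> eventual_interior (D \<circ> s) = eventual_interior D)"

lemma subseq_stable_subseq:
  assumes "subseq_stable D" "strict_mono s"
  shows "subseq_stable (D \<circ> s)"
  using assms unfolding subseq_stable_def by (metis comp_assoc strict_mono_o)

lemma subseq_stable_imp_converges:
  fixes D :: "nat \<Rightarrow> 'a::real_normed_vector set"
  assumes "subseq_stable D"
  shows "converges_Caratheodory (\<lambda>j. (D j, p j)) p_hat"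
proof -
  have "Ker p_hat ((\<lambda>j. (D j, p j)) \<circ> s) = Ker p_hat (\<lambda>j. (D j, p j))" if "strict_mono s" for s
    using assms that Ker_eq[of p_hat "D \<circ> s" "p \<circ> s"] by (simp add: Ker_eq subseq_stable_def o_def)
  then show ?thesis
    by (simp add: converges_Caratheodory_def)
qed

text \<open>For each basic open set some subsequence decides whether it is contained in almost all
  or in almost none of the domains. The diagonal sequence decides this for all of them, so passing
  to a further subsequence cannot enlarge the eventual interior.\<close>

lemma exists_subseq_stable:
  fixes D :: "nat \<Rightarrow> 'a::{metric_space, second_countable_topology} set"
  obtains r where "strict_mono r" "subseq_stable (D \<circ> r)"
proof -
  obtain \<B> :: "'a set set" where \<B>: "countable \<B>" "topological_basis \<B>"
    using ex_countable_basis by blast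
  \<comment> \<open>\<open>from_nat_into\<close> enumerates nonempty countable sets; inserting the
    empty set guarantees nonemptiness.\<close>
  define Bs where "Bs = from_nat_into (insert {} \<B>)"
  have Bs: "range Bs = insert {} \<B>"
    unfolding Bs_def using \<B>(1) by (simp add: range_from_nat_into)
  define P where "P = (\<lambda>n s. (\<forall>\<^sub>F j in sequentially. Bs n \<subseteq> D (s j)) \<or>
      (\<forall>\<^sub>F j in sequentially. \<not> Bs n \<subseteq> D (s j)))"
  interpret subseqs P
  proof
    fix n and s :: "nat \<Rightarrow> nat"
    show "\<exists>r. strict_mono r \<and> P n (s \<circ> r)"
    \<comment> \<open>If the basic set fits infinitely often, those indices form the subsequence;
      otherwise it fits only finitely often and \<open>s\<close> is good already.\<close>
    proof (cases "infinite {j. Bs n \<subseteq> D (s j)}")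
      case True
      then obtain r :: "nat \<Rightarrow> nat" where r: "strict_mono r" "\<And>j. r j \<in> {j. Bs n \<subseteq> D (s j)}"
        using infinite_enumerate by blast
      then show ?thesis
        by (intro exI[of _ r]) (auto simp: P_def)
    next
      case False
      then have "P n s"
        unfolding P_def cofinite_eq_sequentially[symmetric] eventually_cofinite by simp
      then show ?thesis
        by (intro exI[of _ id]) (simp add: strict_mono_id)
    qed
  qed
  have P_subseq: "P n (s \<circ> r)" if "strict_mono r" "P n s" for n s r
    using that eventually_subseq unfolding P_def o_def by blast
  have P_diag: "P n diagseq" for n
  proof -
    \<comment> \<open>\<open>diagseq_holds\<close> speaks only of the tail from \<open>Suc n\<close>
      on; eventual properties ignore the shift.\<close>
    have shift: "(\<forall>\<^sub>F j in sequentially. Q (diagseq (Suc n + j))) \<longleftrightarrow> (\<forall>\<^sub>F j in sequentially. Q (diagseq j))" for Q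
      using eventually_sequentially_seg[of "\<lambda>j. Q (diagseq j)" "Suc n"] by (simp add: add.commute)
    have "P n (diagseq \<circ> (+) (Suc n))"
      by (rule diagseq_holds[OF P_subseq])
    then show ?thesis
      using shift[of "\<lambda>j. Bs n \<subseteq> D j"] shift[of "\<lambda>j. \<not> Bs n \<subseteq> D j"]
      unfolding P_def o_def by simp
  qed
  have "eventual_interior (D \<circ> diagseq \<circ> s) = eventual_interior (D \<circ> diagseq)" if s: "strict_mono s" for s
  proof (intro equalityI subsetI)
    fix x assume "x \<in> eventual_interior (D \<circ> diagseq \<circ> s)"
    then obtain e where e: "e > 0" "\<forall>\<^sub>F j in sequentially. ball x e \<subseteq> D (diagseq (s j))"
      by (auto simp: eventual_interior_def)
    then obtain n where n: "x \<in> Bs n" "Bs n \<subseteq> ball x e" "open (Bs n)"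
      using topological_basisE[OF \<B>(2) open_ball, of x x e] topological_basis_open[OF \<B>(2)] Bs
      by (metis centre_in_ball insertI2 rangeE)
    \<comment> \<open>Containment along \<open>s\<close> contradicts eventual noncontainment along
      \<open>diagseq\<close>, so the other alternative of \<open>P\<close> remains.\<close>
    have "\<not> (\<forall>\<^sub>F j in sequentially. \<not> Bs n \<subseteq> D (diagseq j))"
    proof
      assume "\<forall>\<^sub>F j in sequentially. \<not> Bs n \<subseteq> D (diagseq j)"
      from eventually_subseq[OF s this] e(2) have "\<forall>\<^sub>F j in sequentially. False"
        by eventually_elim (use n(2) in blast)
      then show False
        by simp
    qed
    then have "\<forall>\<^sub>F j in sequentially. Bs n \<subseteq> D (diagseq j)"
      using P_diag[of n] unfolding P_def by blast
    moreover obtain d where "d > 0" "ball x d \<subseteq> Bs n"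
      using n by (meson openE)
    ultimately have "\<forall>\<^sub>F j in sequentially. ball x d \<subseteq> D (diagseq j)"
      by (meson eventually_mono subset_trans)
    then show "x \<in> eventual_interior (D \<circ> diagseq)"
      using \<open>d > 0\<close> by (auto simp: eventual_interior_def)
  next
    fix x assume "x \<in> eventual_interior (D \<circ> diagseq)"
    then show "x \<in> eventual_interior (D \<circ> diagseq \<circ> s)"
      unfolding eventual_interior_def o_def using eventually_subseq[OF s] by blast
  qed
  then show ?thesis
    using that[OF subseq_diagseq] by (simp add: subseq_stable_def)
qed

section \<open>Limits of maps on the eventual interior of their domains\<close>

lemma limit_holomorphic:
  fixes f :: "nat \<Rightarrow> complex^'n \<Rightarrow> complex^'m"
  assumes "open W" "W \<subseteq> eventual_interior D" "\<And>j. holomorphic_map_on (f j) (D j)"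
    and lim: "\<And>z. z \<in> W \<Longrightarrow> \<exists>R>0. uniform_limit (ball z R) f g sequentially"
  shows "holomorphic_map_on g W"
proof (rule holomorphic_map_on_locally)
  fix z assume z: "z \<in> W"
  then obtain R where R: "R > 0" "uniform_limit (ball z R) f g sequentially"
    using lim by blast
  obtain e where e: "e > 0" "\<forall>\<^sub>F j in sequentially. ball z e \<subseteq> D j"
    using z assms(2) by (auto simp: eventual_interior_def)
  have "holomorphic_map_on g (ball z (min R e / 2))"
  proof (rule holomorphic_map_uniform_limit(1))
    show "\<forall>\<^sub>F j in sequentially. holomorphic_map_on (f j) (ball z (min R e))"
      using e(2) by eventually_elim (rule holomorphic_map_on_subset[OF assms(3)], auto)
    show "uniform_limit (ball z (min R e)) f g sequentially"
      by (rule uniform_limit_on_subset[OF R(2)]) auto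
  qed (use R e in auto)
  then show "\<exists>r>0. holomorphic_map_on g (ball z r)"
    using R(1) e(1) by (metis half_gt_zero min_less_iff_conj)
qed

text \<open>Hurwitz spreads the nonvanishing of the limit determinant from \<open>a\<close> over the
  connected set \<open>W\<close>; the uniform open mapping lemma then yields a ball about each value
  of \<open>g\<close> that almost all images cover.\<close>

lemma limit_into_eventual_interior:
  fixes f :: "nat \<Rightarrow> complex^'n \<Rightarrow> complex^'n"
  assumes "open W" "connected W" "W \<subseteq> eventual_interior D" "\<And>j. holomorphic_map_on (f j) (D j)"
    and nz: "\<And>j x. x \<in> D j \<Longrightarrow> det (complex_jacobian (f j) x) \<noteq> 0"
    and lim: "\<And>z. z \<in> W \<Longrightarrow> \<exists>R>0. uniform_limit (ball z R) f g sequentially"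
    and "a \<in> W" "det (complex_jacobian g a) \<noteq> 0"
  shows "g ` W \<subseteq> eventual_interior (\<lambda>j. f j ` D j)"
proof
  fix w assume "w \<in> g ` W"
  then obtain z where z: "z \<in> W" "w = g z"
    by blast
  have loc: "\<exists>R>0. uniform_limit (ball z R) f g sequentially \<and> (\<forall>\<^sub>F j in sequentially. ball z R \<subseteq> D j)"
    if z: "z \<in> W" for z
  proof -
    obtain R where R: "R > 0" "uniform_limit (ball z R) f g sequentially"
      using lim z by blast
    obtain e where e: "e > 0" "\<forall>\<^sub>F j in sequentially. ball z e \<subseteq> D j"
      using z assms(3) by (auto simp: eventual_interior_def)
    have "\<forall>\<^sub>F j in sequentially. ball z (min R e) \<subseteq> D j"
      using e(2) by eventually_elim auto
    then show ?thesis
      using R e by (intro exI[of _ "min R e"]) (auto intro: uniform_limit_on_subset)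
  qed
  have "det (complex_jacobian g z) \<noteq> 0"
  proof (rule det_complex_jacobian_limit_nonzero[OF assms(1,2) _ assms(7,8) z(1)])
    fix x assume "x \<in> W"
    then obtain R where "R > 0" "uniform_limit (ball x R) f g sequentially" and
      sub: "\<forall>\<^sub>F j in sequentially. ball x R \<subseteq> D j"
      using loc by blast
    moreover from sub have "\<forall>\<^sub>F j in sequentially. holomorphic_map_on (f j) (ball x R) \<and>
           (\<forall>y\<in>ball x R. det (complex_jacobian (f j) y) \<noteq> 0)"
      by eventually_elim (use nz holomorphic_map_on_subset[OF assms(4)] in blast)
    ultimately show "\<exists>R>0. uniform_limit (ball x R) f g sequentially \<and>
        (\<forall>\<^sub>F j in sequentially. holomorphic_map_on (f j) (ball x R) \<and>
           (\<forall>y\<in>ball x R. det (complex_jacobian (f j) y) \<noteq> 0))"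
      by blast
  qed
  moreover have "(g has_derivative (\<lambda>v. complex_jacobian g z *v v)) (at z)"
    by (rule has_derivative_complex_jacobian[OF assms(1) limit_holomorphic[OF assms(1,3,4) lim] z(1)])
  moreover obtain R where "R > 0" "uniform_limit (ball z R) f g sequentially" and
      sub: "\<forall>\<^sub>F j in sequentially. ball z R \<subseteq> D j"
    using loc[OF z(1)] by blast
  moreover from sub have "\<forall>\<^sub>F j in sequentially. continuous_on (ball z R) (f j)"
    by eventually_elim (meson assms(4) continuous_on_subset holomorphic_map_on_imp_continuous_on)
  ultimately obtain e where "e > 0" "\<forall>\<^sub>F j in sequentially. ball (g z) e \<subseteq> f j ` ball z R"
    using uniform_open_mapping by metis
  moreover from this(2) sub have "\<forall>\<^sub>F j in sequentially. ball (g z) e \<subseteq> f j ` D j"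
    by eventually_elim blast
  ultimately show "w \<in> eventual_interior (\<lambda>j. f j ` D j)"
    using z(2) by (auto simp: eventual_interior_def)
qed

section \<open>Tautness and domains of vectors\<close>

text \<open>The points of the manifolds in the definition of tautness are sequences, so open sets of
  vectors have to be transported there.\<close>

definition coord_index :: "'n::finite \<Rightarrow> nat" where
  "coord_index = (SOME b. bij_betw b UNIV {..<CARD('n)})"

lemma bij_betw_coord_index: "bij_betw (coord_index :: 'n::finite \<Rightarrow> nat) UNIV {..<CARD('n)}"
  unfolding coord_index_def
  using someI_ex[OF ex_bij_betw_finite_nat[OF finite, of "UNIV :: 'n set"]] by (simp only: atLeast0LessThan)

lemma coord_index_less: "coord_index (i :: 'n::finite) < CARD('n)"
  using bij_betw_coord_index by (auto simp: bij_betw_def)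

definition to_seq :: "complex^'n \<Rightarrow> nat \<Rightarrow> complex" where
  "to_seq x = (\<lambda>k. if k < CARD('n) then x $ inv_into UNIV coord_index k else 0)"

definition of_seq :: "(nat \<Rightarrow> complex) \<Rightarrow> complex^'n" where
  "of_seq z = (\<chi> i. z (coord_index i))"

lemma of_seq_to_seq [simp]: "of_seq (to_seq x) = (x :: complex^'n)"
  using bij_betw_coord_index[where 'n = 'n]
  by (simp add: of_seq_def to_seq_def vec_eq_iff coord_index_less bij_betw_def)

lemma to_seq_of_seq: "(\<And>k. k \<ge> CARD('n) \<Longrightarrow> z k = 0) \<Longrightarrow> to_seq (of_seq z :: complex^'n) = z"
  using bij_betw_coord_index[where 'n = 'n]
  by (auto simp: of_seq_def to_seq_def fun_eq_iff bij_betw_def f_inv_into_f)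

lemma range_to_seq: "range (to_seq :: complex^'n \<Rightarrow> _) = {z. \<forall>k\<ge>CARD('n). z k = 0}"
proof (intro equalityI subsetI)
  fix z :: "nat \<Rightarrow> complex" assume "z \<in> {z. \<forall>k\<ge>CARD('n). z k = 0}"
  then have "z = to_seq (of_seq z :: complex^'n)"
    by (simp add: to_seq_of_seq)
  then show "z \<in> range (to_seq :: complex^'n \<Rightarrow> _)"
    by blast
qed (auto simp: to_seq_def)

lemma continuous_on_to_seq: "continuous_on (S :: (complex^'n) set) to_seq"
  unfolding to_seq_def
proof (rule continuous_on_coordinatewise_then_product)
  fix k
  show "continuous_on S (\<lambda>x :: complex^'n. if k < CARD('n) then x $ inv_into UNIV coord_index k else 0)"
    by (cases "k < CARD('n)") (auto intro!: continuous_intros)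
qed

lemma continuous_on_of_seq: "continuous_on S of_seq"
  unfolding of_seq_def by (intro continuous_on_vec_lambda continuous_on_product_coordinates continuous_on_subset[OF _ subset_UNIV])

text \<open>Inside the model space, the image under \<open>to_seq\<close> is the preimage of
  \<open>W\<close> under the continuous left inverse \<open>of_seq\<close>.\<close>

lemma openin_to_seq_image:
  fixes W :: "(complex^'n) set"
  assumes "open W"
  shows "openin (complex_space CARD('n)) (to_seq ` W)"
proof -
  have "to_seq ` W = range (to_seq :: complex^'n \<Rightarrow> _) \<inter> of_seq -` W"
    by force
  then show ?thesis
    unfolding complex_space_def range_to_seq[symmetric]
    using openin_open_Int[OF open_vimage[OF assms continuous_on_of_seq]] by metis
qed

lemma L2_set_of_seq: "L2_set (\<lambda>i. norm (w i - z i)) {..<CARD('n)} = norm (of_seq w - of_seq z :: complex^'n)"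
  unfolding L2_set_def norm_vec_def
  by (subst sum.reindex_bij_betw[OF bij_betw_coord_index, symmetric]) (simp add: of_seq_def)

lemma holomorphic_fun_on_cong:
  assumes "holomorphic_fun_on m f S" "\<And>z. z \<in> S \<Longrightarrow> f z = g z"
  shows "holomorphic_fun_on m g S"
  unfolding holomorphic_fun_on_def
proof
  fix z assume z: "z \<in> S"
  then obtain a where a: "((\<lambda>w. norm (f w - f z - (\<Sum>i<m. a i * (w i - z i))) / L2_set (\<lambda>i. norm (w i - z i)) {..<m})
      \<longlongrightarrow> 0) (at z within S)"
    using assms(1) unfolding holomorphic_fun_on_def by blast
  have "((\<lambda>w. norm (g w - g z - (\<Sum>i<m. a i * (w i - z i))) / L2_set (\<lambda>i. norm (w i - z i)) {..<m})
      \<longlongrightarrow> 0) (at z within S)"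
    by (rule tendsto_cong[THEN iffD1, OF _ a], unfold eventually_at_filter)
      (intro always_eventually allI impI, simp only: assms(2) z)
  then show "\<exists>a. ((\<lambda>w. norm (g w - g z - (\<Sum>i<m. a i * (w i - z i))) / L2_set (\<lambda>i. norm (w i - z i)) {..<m})
      \<longlongrightarrow> 0) (at z within S)"
    by blast
qed

text \<open>\<open>of_seq\<close> carries the \<open>L2_set\<close> distance to the norm distance,
  so the difference quotient for vectors is simply pulled back.\<close>

lemma holomorphic_fun_on_of_seq:
  fixes f :: "complex^'n \<Rightarrow> complex^'m"
  assumes "open W" "holomorphic_map_on f W"
  shows "holomorphic_fun_on CARD('n) (\<lambda>z. f (of_seq z) $ i) (to_seq ` W)"
  unfolding holomorphic_fun_on_def
proof
  fix z assume "z \<in> to_seq ` W"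
  then obtain x where x: "x \<in> W" "z = to_seq x"
    by blast
  define J where "J = complex_jacobian f x"
  have "((\<lambda>y. f y $ i) has_derivative (\<lambda>v. (J *v v) $ i)) (at x within W)"
    unfolding J_def
    by (rule has_derivative_at_withinI, rule bounded_linear.has_derivative[OF bounded_linear_vec_nth])
      (rule has_derivative_complex_jacobian[OF assms x(1)])
  then have "((\<lambda>y. ((f y $ i - f x $ i) - (J *v (y - x)) $ i) /\<^sub>R norm (y - x)) \<longlongrightarrow> 0) (at x within W)"
    unfolding has_derivative_at_within by simp
  from tendsto_norm_zero[OF this] have "((\<lambda>y. norm (f y $ i - f x $ i - (J *v (y - x)) $ i) / norm (y - x)) \<longlongrightarrow> 0) (at x within W)"
    by (simp add: divide_inverse mult.commute)
  \<comment> \<open>The limit is over punctured neighbourhoods, so injectivity of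
    \<open>of_seq\<close> on the image of \<open>W\<close> is part of the claim.\<close>
  moreover have "filterlim of_seq (at x within W) (at z within to_seq ` W)"
    unfolding filterlim_at
  proof
    have "((of_seq :: _ \<Rightarrow> complex^'n) \<longlongrightarrow> of_seq z) (at z within to_seq ` W)"
      using continuous_on_of_seq[of "to_seq ` W"] x by (auto simp only: continuous_on_def)
    then show "(of_seq \<longlongrightarrow> x) (at z within to_seq ` W)"
      unfolding x(2) of_seq_to_seq .
    show "\<forall>\<^sub>F w in at z within to_seq ` W. of_seq w \<in> W \<and> of_seq w \<noteq> x"
      unfolding eventually_at_filter x(2) by (rule always_eventually) auto
  qed
  ultimately have *: "((\<lambda>w. norm (f (of_seq w) $ i - f x $ i - (J *v (of_seq w - x)) $ i) / norm (of_seq w - x)) \<longlongrightarrow> 0)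
      (at z within to_seq ` W)"
    by (rule filterlim_compose)
  \<comment> \<open>The coefficients are the \<open>i\<close>-th row of the Jacobian, listed in the
    order of \<open>coord_index\<close>.\<close>
  have "(\<Sum>k<CARD('n). J $ i $ inv_into UNIV coord_index k * (w k - z k)) = (J *v (of_seq w - of_seq z)) $ i" for w
    using bij_betw_coord_index[where 'n = 'n] unfolding matrix_vector_mult_def
    by (subst sum.reindex_bij_betw[OF bij_betw_coord_index, symmetric]) (simp add: of_seq_def bij_betw_def)
  with * show "\<exists>a. ((\<lambda>w. norm (f (of_seq w) $ i - f (of_seq z) $ i - (\<Sum>k<CARD('n). a k * (w k - z k))) /
      L2_set (\<lambda>k. norm (w k - z k)) {..<CARD('n)}) \<longlongrightarrow> 0) (at z within to_seq ` W)"
    by (intro exI[of _ "\<lambda>k. J $ i $ inv_into UNIV coord_index k"]) (simp add: L2_set_of_seq x(2))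
qed

lemma holomorphic_fun_on_coordinate:
  assumes "k < m"
  shows "holomorphic_fun_on m (\<lambda>z. z k) S"
  unfolding holomorphic_fun_on_def
proof (intro ballI exI)
  fix z assume "z \<in> S"
  show "((\<lambda>w. norm (w k - z k - (\<Sum>i<m. (if i = k then 1 else 0) * (w i - z i))) /
      L2_set (\<lambda>i. norm (w i - z i)) {..<m}) \<longlongrightarrow> 0) (at z within S)"
    using assms by (simp add: if_distrib[of "\<lambda>x. x * _"] sum.delta cong: if_cong)
qed

text \<open>One global chart, the identity, suffices; compatibility then reduces to holomorphy of
  the coordinate functions.\<close>

lemma complex_manifold_to_seq:
  fixes W :: "(complex^'n) set"
  assumes "open W" "connected W"
  shows "complex_manifold CARD('n) (top_of_set (to_seq ` W)) {(to_seq ` W, \<lambda>z. z)}"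
proof -
  let ?U = "to_seq ` W"
  have "second_countable (euclidean :: (nat \<Rightarrow> complex) topology)"
    unfolding second_countable_def open_openin[symmetric]
    using ex_countable_basis[where 'a = "nat \<Rightarrow> complex"] topological_basisE topological_basis_open by metis
  then have "second_countable (top_of_set ?U)"
    by (rule second_countable_subtopology)
  moreover have "Hausdorff_space (top_of_set ?U)"
    by (simp add: Hausdorff_space_subtopology)
  moreover have "connected_space (top_of_set ?U)"
    using assms(2) connected_continuous_image[OF continuous_on_to_seq]
    by (metis connected_space_subtopology connectedin_iff_connected connectedin_def)
  moreover have "subtopology (complex_space CARD('n)) ?U = top_of_set ?U"
    unfolding complex_space_def range_to_seq[symmetric] subtopology_subtopology
    by (simp add: Int_absorb1 image_mono)
  moreover have "holomorphic_fun_on CARD('n) (\<lambda>z. inv_into ?U (\<lambda>z. z) z i) ?U" if "i < CARD('n)" for i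
    by (rule holomorphic_fun_on_cong[OF holomorphic_fun_on_coordinate[OF that]])
      (simp add: inv_into_f_eq[of "\<lambda>z. z"])
  ultimately show ?thesis
    unfolding complex_manifold_def using openin_to_seq_image[OF assms(1)]
    by (simp add: subtopology_subtopology homeomorphic_map_id[unfolded id_def])
qed

section \<open>Extraction of convergent subsequences by tautness\<close>

text \<open>The condition \<open>meet\<close> survives in subsequences and contradicts compact
  divergence, so normality leaves local uniform convergence, which is carried back from sequences to
  vectors.\<close>

lemma taut_subsequence:
  fixes G :: "(complex^'m) set" and W :: "(complex^'n) set" and h :: "nat \<Rightarrow> complex^'n \<Rightarrow> complex^'m"
  assumes "taut G" "open W" "connected W"
    and hol: "\<And>j. holomorphic_map_on (h j) W" and im: "\<And>j. h j ` W \<subseteq> G"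
    and K: "compact K" "K \<subseteq> W" and L: "compact L" "L \<subseteq> G"
    and meet: "\<forall>\<^sub>F j in sequentially. h j ` K \<inter> L \<noteq> {}"
  obtains s g where "strict_mono s" "\<And>z. z \<in> W \<Longrightarrow> \<exists>R>0. uniform_limit (ball z R) (h \<circ> s) g sequentially"
proof -
  let ?U = "to_seq ` W"
  let ?M = "top_of_set ?U"
  let ?A = "{(?U, \<lambda>z :: nat \<Rightarrow> complex. z)}"
  define H where "H = (\<lambda>j. h j \<circ> of_seq)"
  have "H j \<in> holomorphic_maps CARD('n) ?M ?A G" for j
  proof -
    have "holomorphic_fun_on CARD('n) (\<lambda>z. H j (inv_into ?U (\<lambda>z. z) z) $ i) ?U" for i
      by (rule holomorphic_fun_on_cong[OF holomorphic_fun_on_of_seq[OF assms(2) hol]])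
        (simp add: H_def inv_into_f_eq[of "\<lambda>z. z"])
    then show ?thesis
      using im[of j] by (auto simp: holomorphic_maps_def H_def)
  qed
  moreover have "normal_family CARD('n) ?M ?A G (holomorphic_maps CARD('n) ?M ?A G)"
    using assms(1) complex_manifold_to_seq[OF assms(2,3)] unfolding taut_def by blast
  ultimately obtain s where s: "strict_mono s"
    "(\<exists>g. locally_uniform_limit ?M (H \<circ> s) g) \<or> compactly_divergent ?M G (H \<circ> s)"
    unfolding normal_family_def by (metis image_subsetI)
  have "\<not> compactly_divergent ?M G (H \<circ> s)"
  proof
    \<comment> \<open>In a Hausdorff space compact sets are closed, so each is its own
      closure.\<close>
    have rel: "relatively_compact_in (top_of_set S) C" if "compact C" "C \<subseteq> S" for C S :: "'x::t2_space set"
      using that unfolding relatively_compact_in_def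
      by (simp add: closure_of_subtopology closure_closed compact_imp_closed compactin_subtopology Int_absorb1 Int_absorb2)
    assume "compactly_divergent ?M G (H \<circ> s)"
    moreover have "relatively_compact_in ?M (to_seq ` K)"
      using K by (intro rel compact_continuous_image continuous_on_to_seq image_mono)
    moreover have "relatively_compact_in (top_of_set G) L"
      using L by (rule rel)
    ultimately obtain j0 where j0: "\<And>j. j \<ge> j0 \<Longrightarrow> (H \<circ> s) j ` (to_seq ` K) \<inter> L = {}"
      unfolding compactly_divergent_def by blast
    have "\<forall>\<^sub>F j in sequentially. h (s j) ` K \<inter> L \<noteq> {}"
      using eventually_subseq[OF s(1) meet] .
    then have "\<forall>\<^sub>F j in sequentially. j \<ge> j0 \<and> h (s j) ` K \<inter> L \<noteq> {}"
      using eventually_ge_at_top by (rule eventually_conj[rotated])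
    then obtain j where "j \<ge> j0" "h (s j) ` K \<inter> L \<noteq> {}"
      using eventually_happens'[OF sequentially_bot] by blast
    then show False
      using j0[of j] by (simp add: H_def image_image)
  qed
  then obtain g where g: "locally_uniform_limit ?M (H \<circ> s) g"
    using s(2) by blast
  show ?thesis
  proof (rule that[OF s(1)])
    fix z assume z: "z \<in> W"
    then obtain V where V: "openin ?M V" "to_seq z \<in> V" "uniform_limit V (H \<circ> s) g sequentially"
      using g unfolding locally_uniform_limit_def by force
    obtain V' where "open V'" "V = ?U \<inter> V'"
      using V(1) by (auto simp: openin_open)
    moreover have "open (to_seq -` V' :: (complex^'n) set)"
      by (rule open_vimage[OF \<open>open V'\<close> continuous_on_to_seq])
    ultimately have "open (W \<inter> to_seq -` V')" "z \<in> W \<inter> to_seq -` V'"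
      using V(2) z assms(2) by auto
    then obtain R where "R > 0" "ball z R \<subseteq> W \<inter> to_seq -` V'"
      unfolding open_contains_ball by blast
    then have "to_seq ` ball z R \<subseteq> V"
      using \<open>V = ?U \<inter> V'\<close> by blast
    then have "uniform_limit (ball z R) (\<lambda>j x. (H \<circ> s) j (to_seq x)) (\<lambda>x. g (to_seq x)) sequentially"
      by (intro uniform_limit_compose'[OF V(3)]) blast
    then show "\<exists>R>0. uniform_limit (ball z R) (h \<circ> s) (\<lambda>x. g (to_seq x)) sequentially"
      using \<open>R > 0\<close> by (auto simp: H_def o_def)
  qed
qed

section \<open>Limits of biholomorphic maps\<close>

text \<open>Triangle inequality through \<open>g (y j)\<close>. It permits limits in compositions
  where the inner point moves along with the outer map.\<close>

lemma uniform_limit_tendsto_diagonal: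
  fixes f :: "nat \<Rightarrow> 'a::metric_space \<Rightarrow> 'b::metric_space"
  assumes "uniform_limit S f g sequentially" "isCont g x" "y \<longlonglongrightarrow> x" "\<forall>\<^sub>F j in sequentially. y j \<in> S"
  shows "(\<lambda>j. f j (y j)) \<longlonglongrightarrow> g x"
proof (rule tendstoI)
  fix e :: real assume "e > 0"
  then have e: "e / 2 > 0" by simp
  have "(\<lambda>j. g (y j)) \<longlonglongrightarrow> g x"
    using assms(2,3) by (rule isCont_tendsto_compose)
  then have "\<forall>\<^sub>F j in sequentially. dist (g (y j)) (g x) < e / 2"
    using e by (rule tendstoD)
  moreover have "\<forall>\<^sub>F j in sequentially. \<forall>z\<in>S. dist (f j z) (g z) < e / 2"
    using assms(1) e by (rule uniform_limitD)
  ultimately show "\<forall>\<^sub>F j in sequentially. dist (f j (y j)) (g x) < e"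
    using assms(4)
  proof eventually_elim
    case (elim j)
    then have "dist (f j (y j)) (g (y j)) < e / 2"
      by blast
    then show ?case
      using elim(1) dist_triangle[of "f j (y j)" "g x" "g (y j)"] by linarith
  qed
qed

lemma locally_uniform_limit_tendsto:
  assumes "open W" "continuous_on W g" "x \<in> W" "y \<longlonglongrightarrow> x"
    and "\<exists>R>0. uniform_limit (ball x R) f g sequentially"
  shows "(\<lambda>j. f j (y j)) \<longlonglongrightarrow> g x"
proof -
  obtain R where R: "R > 0" "uniform_limit (ball x R) f g sequentially"
    using assms(5) by blast
  show ?thesis
  proof (rule uniform_limit_tendsto_diagonal[OF R(2) _ assms(4)])
    show "isCont g x"
      using assms(1-3) continuous_on_eq_continuous_at by blast
    show "\<forall>\<^sub>F j in sequentially. y j \<in> ball x R"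
      using assms(4) R(1) by (auto simp: tendsto_iff dist_commute)
  qed
qed

section \<open>Tamed sequences, subsequences and biholomorphic maps\<close>

lemma eventual_interior_subseq:
  assumes "strict_mono s"
  shows "eventual_interior D \<subseteq> eventual_interior (D \<circ> s)"
  unfolding eventual_interior_def o_def using eventually_subseq[OF assms] by blast

lemma eventual_interior_eventually_mem:
  assumes "x \<in> eventual_interior D" "y \<longlonglongrightarrow> x"
  shows "\<forall>\<^sub>F j in sequentially. y j \<in> D j"
proof -
  obtain e where e: "e > 0" "\<forall>\<^sub>F j in sequentially. ball x e \<subseteq> D j"
    using assms(1) by (auto simp: eventual_interior_def)
  have "\<forall>\<^sub>F j in sequentially. y j \<in> ball x e"
    using assms(2) e(1) by (auto simp: tendsto_iff dist_commute)
  with e(2) show ?thesis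
    by eventually_elim blast
qed

lemma tamed_atD:
  assumes "tamed_at (\<lambda>j. (D j, p j)) p_hat"
  shows "open (D j)" "p j \<in> D j" "p \<longlonglongrightarrow> p_hat" "p_hat \<in> eventual_interior D"
proof -
  show "open (D j)" "p j \<in> D j" "p \<longlonglongrightarrow> p_hat"
    using assms by (auto simp: tamed_at_def pointed_domain_def)
  obtain k U where "open U" "p_hat \<in> U" "U \<subseteq> (\<Inter>j\<in>{k..}. D j)"
    using assms unfolding tamed_at_def fst_conv by blast
  then show "p_hat \<in> eventual_interior D"
    unfolding eventual_interior_eq by (metis UN_I UNIV_I interior_maximal subsetD)
qed

lemma tamed_at_subseq:
  fixes D :: "nat \<Rightarrow> 'a::metric_space set"
  assumes "tamed_at (\<lambda>j. (D j, p j)) p_hat" "strict_mono r"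
  shows "tamed_at (\<lambda>j. (D (r j), p (r j))) p_hat"
proof -
  obtain k U where U: "open U" "p_hat \<in> U" "U \<subseteq> (\<Inter>j\<in>{k..}. D j)"
    using assms(1) unfolding tamed_at_def fst_conv by blast
  then have "U \<subseteq> (\<Inter>j\<in>{k..}. D (r j))"
    using seq_suble[OF assms(2)] by (force intro: order_trans)
  moreover have "(\<lambda>j. p (r j)) \<longlonglongrightarrow> p_hat"
    using LIMSEQ_subseq_LIMSEQ[OF tamed_atD(3)[OF assms(1)] assms(2)] by (simp add: o_def)
  ultimately show ?thesis
    using assms(1) U(1,2) unfolding tamed_at_def fst_conv snd_conv by blast
qed

lemma biholomorphic_mapD:
  fixes f :: "complex^'n \<Rightarrow> complex^'n"
  assumes "biholomorphic_map f S T" "open S" "open T"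
  shows "f ` S = T" "inv_into S f ` T = S"
    and "\<And>x. x \<in> S \<Longrightarrow> inv_into S f (f x) = x" "\<And>y. y \<in> T \<Longrightarrow> f (inv_into S f y) = y"
    and "\<And>x. x \<in> S \<Longrightarrow> det (complex_jacobian f x) \<noteq> 0"
    and "\<And>y. y \<in> T \<Longrightarrow> det (complex_jacobian (inv_into S f) y) \<noteq> 0"
proof -
  let ?h = "inv_into S f"
  have bij: "bij_betw f S T" and hol: "holomorphic_map_on f S" "holomorphic_map_on ?h T"
    using assms(1) by (auto simp: biholomorphic_map_def)
  show im: "f ` S = T" "?h ` T = S"
    using bij bij_betw_inv_into[OF bij] by (auto simp: bij_betw_def)
  show inv: "\<And>x. x \<in> S \<Longrightarrow> ?h (f x) = x" "\<And>y. y \<in> T \<Longrightarrow> f (?h y) = y"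
    using bij by (auto simp: bij_betw_inv_into_left bij_betw_inv_into_right)
  show det: "det (complex_jacobian f x) \<noteq> 0" if "x \<in> S" for x
    by (rule det_complex_jacobian_left_inverse(1)[OF has_derivative_complex_jacobian[OF assms(2) hol(1) that]
          has_derivative_complex_jacobian[OF assms(3) hol(2)] assms(2) that inv(1)])
      (use that im in auto)
  show "det (complex_jacobian ?h y) \<noteq> 0" if "y \<in> T" for y
    by (rule det_complex_jacobian_left_inverse(1)[OF has_derivative_complex_jacobian[OF assms(3) hol(2) that]
          has_derivative_complex_jacobian[OF assms(2) hol(1)] assms(3) that inv(2)])
      (use that im in auto)
qed

section \<open>The inverse of the limit map\<close>

text \<open>A single stage \<open>W\<close> of the kernel lies in \<open>G j\<close> for all
  \<open>j \<ge> k\<close>, so the inverses from index \<open>k\<close> on have \<open>W\<close> as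
  a common domain and one application of tautness gives a limit \<open>h\<close> there.\<close>

lemma limit_local_inverse:
  fixes D G :: "nat \<Rightarrow> (complex^'n) set" and f :: "nat \<Rightarrow> complex^'n \<Rightarrow> complex^'n" and k :: nat
  assumes D: "tamed_at (\<lambda>j. (D j, p j)) p_hat" and G: "tamed_at (\<lambda>j. (G j, q j)) q_hat"
    and "taut T" and DT: "\<And>j. D j \<subseteq> T" and bihol: "\<And>j. biholomorphic_map (f j) (D j) (G j)"
    and fp: "\<And>j. f j (p j) = q j" and stable: "subseq_stable D"
    and lim: "\<And>z. z \<in> connected_component_set (eventual_interior D) p_hat \<Longrightarrow>
        \<exists>R>0. uniform_limit (ball z R) f g sequentially"
  defines "D_hat \<equiv> connected_component_set (eventual_interior D) p_hat"
    and "G_hat \<equiv> connected_component_set (eventual_interior G) q_hat"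
    and "W \<equiv> connected_component_set (interior (\<Inter>j\<in>{k..}. G j)) q_hat"
  assumes q_W: "q_hat \<in> W"
  obtains h where "g ` D_hat \<subseteq> G_hat" "g p_hat = q_hat" "holomorphic_map_on g D_hat" "holomorphic_map_on h W"
    "h ` W \<subseteq> D_hat" "\<And>w. w \<in> W \<Longrightarrow> g (h w) = w" "\<And>z. z \<in> D_hat \<Longrightarrow> g z \<in> W \<Longrightarrow> h (g z) = z"
proof -
  note D' = tamed_atD[OF D] and G' = tamed_atD[OF G]
  note bij = biholomorphic_mapD[OF bihol D'(1) G'(1)]
  define H where "H = (\<lambda>j. inv_into (D j) (f j))"
  have hol_f: "holomorphic_map_on (f j) (D j)" and hol_H: "holomorphic_map_on (H j) (G j)" for j
    using bihol[of j] by (auto simp: biholomorphic_map_def H_def)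
  have D_hat: "open D_hat" "connected D_hat" "D_hat \<subseteq> eventual_interior D" "p_hat \<in> D_hat"
    unfolding D_hat_def using D'(4)
    by (auto simp: open_connected_component open_eventual_interior connected_component_subset)
  have W: "open W" "connected W"
    unfolding W_def by (auto simp: open_connected_component)
  have W_G: "W \<subseteq> G j" if "j \<ge> k" for j
  proof -
    have "W \<subseteq> (\<Inter>j\<in>{k..}. G j)"
      unfolding W_def using connected_component_subset interior_subset by (rule order_trans)
    then show ?thesis
      using that by blast
  qed
  have W_EI: "W \<subseteq> eventual_interior G"
    unfolding W_def eventual_interior_eq using connected_component_subset by fastforce
  have hol_g: "holomorphic_map_on g D_hat"
    using lim limit_holomorphic[OF D_hat(1,3) hol_f] unfolding D_hat_def by blast
  note cont_g = holomorphic_map_on_imp_continuous_on[OF hol_g]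
  note lim' = lim[folded D_hat_def]
  have "(\<lambda>j. f j (p j)) \<longlonglongrightarrow> g p_hat"
    by (rule locally_uniform_limit_tendsto[OF D_hat(1) cont_g D_hat(4) D'(3) lim'[OF D_hat(4)]])
  then have gp: "g p_hat = q_hat"
    unfolding fp using G'(3) by (rule LIMSEQ_unique)

  \<comment> \<open>Closed balls about \<open>q_hat\<close> and \<open>p_hat\<close> are the compact
    sets that exclude divergence: the inverses send \<open>q j\<close> to
    \<open>p j\<close>.\<close>
  obtain e where e: "e > 0" "cball q_hat e \<subseteq> W"
    using W(1) q_W open_contains_cball by blast
  have "p_hat \<in> T"
    using eventual_interior_eventually_mem[OF D'(4) tendsto_const] DT
    by (auto simp: eventually_sequentially)
  then obtain d where d: "d > 0" "cball p_hat d \<subseteq> T"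
    using \<open>taut T\<close> open_contains_cball unfolding taut_def by blast
  obtain s h where s: "strict_mono s"
    and lim_h: "\<And>w. w \<in> W \<Longrightarrow> \<exists>R>0. uniform_limit (ball w R) ((\<lambda>j. H (j + k)) \<circ> s) h sequentially"
  proof (rule taut_subsequence[OF \<open>taut T\<close> W _ _ compact_cball e(2) compact_cball d(2)])
    show "holomorphic_map_on (H (j + k)) W" for j
      by (rule holomorphic_map_on_subset[OF hol_H W_G]) simp
    show "H (j + k) ` W \<subseteq> T" for j
      using W_G[of "j + k"] bij(2)[of "j + k"] DT[of "j + k"] unfolding H_def by auto
    have "\<forall>\<^sub>F j in sequentially. q j \<in> cball q_hat e" "\<forall>\<^sub>F j in sequentially. p j \<in> cball p_hat d"
      using eventually_mono[OF tendstoD[OF G'(3) e(1)]] eventually_mono[OF tendstoD[OF D'(3) d(1)]]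
      by (simp_all add: dist_commute less_imp_le)
    then have "\<forall>\<^sub>F j in sequentially. H j ` cball q_hat e \<inter> cball p_hat d \<noteq> {}"
    proof eventually_elim
      case (elim j)
      have "H j (q j) = p j"
        unfolding H_def fp[symmetric] using bij(3) D'(2) by blast
      then show ?case
        using elim by force
    qed
    then show "\<forall>\<^sub>F j in sequentially. H (j + k) ` cball q_hat e \<inter> cball p_hat d \<noteq> {}"
      by (rule sequentially_offset)
  qed blast
  \<comment> \<open>Subsequence and shift in one index map; the shift ensures
    \<open>W \<subseteq> G (\<sigma> j)\<close> for every \<open>j\<close>.\<close>
  define \<sigma> where "\<sigma> = (\<lambda>j. s j + k)"
  have \<sigma>: "strict_mono \<sigma>"
    using s by (auto simp: \<sigma>_def strict_mono_def)
  have lim_h: "\<exists>R>0. uniform_limit (ball w R) (\<lambda>j. H (\<sigma> j)) h sequentially" if "w \<in> W" for w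
    using lim_h[OF that] by (simp add: \<sigma>_def o_def)
  have W_EI': "W \<subseteq> eventual_interior (G \<circ> \<sigma>)"
    using W_EI eventual_interior_subseq[OF \<sigma>] by blast
  have hol_h: "holomorphic_map_on h W"
    by (rule limit_holomorphic[OF W(1) W_EI' _ lim_h]) (simp add: hol_H)
  note cont_h = holomorphic_map_on_imp_continuous_on[OF hol_h]

  \<comment> \<open>The inverses are evaluated at the moving points \<open>f (\<sigma> j) z\<close>,
    which converge to \<open>g z\<close> in \<open>W\<close>.\<close>
  have hg: "h (g z) = z" if z: "z \<in> D_hat" "g z \<in> W" for z
  proof -
    have "(\<lambda>j. f j z) \<longlonglongrightarrow> g z"
      by (rule locally_uniform_limit_tendsto[OF D_hat(1) cont_g z(1) tendsto_const lim'[OF z(1)]])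
    then have "(\<lambda>j. f (\<sigma> j) z) \<longlonglongrightarrow> g z"
      using LIMSEQ_subseq_LIMSEQ[OF _ \<sigma>] by (auto simp: o_def)
    then have "(\<lambda>j. H (\<sigma> j) (f (\<sigma> j) z)) \<longlonglongrightarrow> h (g z)"
      by (rule locally_uniform_limit_tendsto[OF W(1) cont_h z(2) _ lim_h[OF z(2)]])
    moreover have "\<forall>\<^sub>F j in sequentially. H (\<sigma> j) (f (\<sigma> j) z) = z"
    proof -
      have "z \<in> eventual_interior D"
        using z(1) D_hat(3) by blast
      then have "\<forall>\<^sub>F j in sequentially. z \<in> D j"
        by (rule eventual_interior_eventually_mem) (rule tendsto_const)
      from eventually_subseq[OF \<sigma> this] show ?thesis
        by eventually_elim (use bij(3) in \<open>auto simp: H_def\<close>)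
    qed
    ultimately have "(\<lambda>j. z) \<longlonglongrightarrow> h (g z)"
      by (rule Lim_transform_eventually)
    then show ?thesis
      using LIMSEQ_unique tendsto_const by metis
  qed
  \<comment> \<open>On this neighbourhood of \<open>p_hat\<close> the map \<open>h\<close> is a left
    inverse of \<open>g\<close>, which makes both determinants nonzero at the base points. They are
    the starting points for Hurwitz.\<close>
  have "open (D_hat \<inter> g -` W)" "p_hat \<in> D_hat \<inter> g -` W"
    using continuous_open_preimage[OF cont_g D_hat(1) W(1)] D_hat(4) q_W gp by auto
  then have det: "det (complex_jacobian g p_hat) \<noteq> 0" "det (complex_jacobian h q_hat) \<noteq> 0"
    using det_complex_jacobian_left_inverse[of g _ p_hat h, OF
        has_derivative_complex_jacobian[OF D_hat(1) hol_g D_hat(4)]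
        has_derivative_complex_jacobian[OF W(1) hol_h], of "D_hat \<inter> g -` W"] q_W hg gp
    by auto
  have "g ` D_hat \<subseteq> eventual_interior (\<lambda>j. f j ` D j)"
    using limit_into_eventual_interior[OF D_hat(1-3) hol_f bij(5) lim' D_hat(4) det(1)] .
  then have "g ` D_hat \<subseteq> eventual_interior G"
    by (simp add: bij(1))
  moreover have "connected (g ` D_hat)" "q_hat \<in> g ` D_hat"
    using connected_continuous_image[OF cont_g D_hat(2)] D_hat(4) gp by auto
  ultimately have g_im: "g ` D_hat \<subseteq> G_hat"
    unfolding G_hat_def by (intro connected_component_maximal)

  \<comment> \<open>The same argument for the inverses, whose images are the domains along
    \<open>\<sigma>\<close>.\<close>
  have "h ` W \<subseteq> eventual_interior (\<lambda>j. H (\<sigma> j) ` (G \<circ> \<sigma>) j)"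
    using limit_into_eventual_interior[OF W W_EI' _ _ lim_h q_W det(2)] hol_H bij(6)
    by (auto simp: H_def)
  also have "(\<lambda>j. H (\<sigma> j) ` (G \<circ> \<sigma>) j) = D \<circ> \<sigma>"
    by (auto simp: H_def bij(2) fun_eq_iff)
  \<comment> \<open>Here stability enters: \<open>h\<close> is a limit along \<open>\<sigma>\<close>
    only, yet its values must lie in the kernel of the whole sequence.\<close>
  also have "eventual_interior (D \<circ> \<sigma>) = eventual_interior D"
    using stable \<sigma> by (simp add: subseq_stable_def)
  finally have "h ` W \<subseteq> eventual_interior D" .
  moreover have "h q_hat = p_hat"
    using hg[of p_hat] D_hat(4) gp q_W by simp
  then have "p_hat \<in> h ` W"
    using q_W by force
  moreover have "connected (h ` W)"
    by (rule connected_continuous_image[OF cont_h W(2)])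
  ultimately have h_im: "h ` W \<subseteq> D_hat"
    unfolding D_hat_def by (intro connected_component_maximal)

  \<comment> \<open>Only now, with \<open>h w\<close> known to lie in \<open>D_hat\<close>, does
    convergence of \<open>f (\<sigma> j)\<close> near \<open>h w\<close> become available.\<close>
  have gh: "g (h w) = w" if w: "w \<in> W" for w
  proof -
    have hw: "h w \<in> D_hat"
      using h_im w by blast
    have "(\<lambda>j. H (\<sigma> j) w) \<longlonglongrightarrow> h w"
      by (rule locally_uniform_limit_tendsto[OF W(1) cont_h w tendsto_const lim_h[OF w]])
    moreover have "\<exists>R>0. uniform_limit (ball (h w) R) (\<lambda>j. f (\<sigma> j)) g sequentially"
      using lim'[OF hw] filterlim_compose[OF _ filterlim_subseq[OF \<sigma>]] by blast
    ultimately have "(\<lambda>j. f (\<sigma> j) (H (\<sigma> j) w)) \<longlonglongrightarrow> g (h w)"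
      by (intro locally_uniform_limit_tendsto[OF D_hat(1) cont_g hw])
    moreover have "f (\<sigma> j) (H (\<sigma> j) w) = w" for j
      using bij(4)[of w "\<sigma> j"] W_G[of "\<sigma> j"] w by (auto simp: H_def \<sigma>_def)
    ultimately show ?thesis
      using LIMSEQ_unique tendsto_const by (metis (no_types, lifting) ext)
  qed
  show ?thesis
    by (rule that[OF g_im gp hol_g hol_h h_im gh hg])
qed

text \<open>The stages \<open>W k\<close> exhaust \<open>G_hat\<close>. Injectivity, surjectivity
  and holomorphy of the inverse are each checked near one value, hence on one stage with its own
  local inverse.\<close>

lemma limit_biholomorphic:
  fixes D G :: "nat \<Rightarrow> (complex^'n) set" and f :: "nat \<Rightarrow> complex^'n \<Rightarrow> complex^'n"
  assumes D: "tamed_at (\<lambda>j. (D j, p j)) p_hat" and G: "tamed_at (\<lambda>j. (G j, q j)) q_hat"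
    and "taut T" and DT: "\<And>j. D j \<subseteq> T" and bihol: "\<And>j. biholomorphic_map (f j) (D j) (G j)"
    and fp: "\<And>j. f j (p j) = q j" and stable: "subseq_stable D"
    and lim: "\<And>z. z \<in> connected_component_set (eventual_interior D) p_hat \<Longrightarrow>
        \<exists>R>0. uniform_limit (ball z R) f g sequentially"
  defines "D_hat \<equiv> connected_component_set (eventual_interior D) p_hat"
    and "G_hat \<equiv> connected_component_set (eventual_interior G) q_hat"
  shows "biholomorphic_map g D_hat G_hat \<and> g p_hat = q_hat"
proof -
  define W where "W = (\<lambda>k. connected_component_set (interior (\<Inter>j\<in>{k..}. G j)) q_hat)"
  have local_inverse: "\<exists>h. g ` D_hat \<subseteq> G_hat \<and> g p_hat = q_hat \<and> holomorphic_map_on g D_hat \<and>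
      holomorphic_map_on h (W k) \<and> h ` W k \<subseteq> D_hat \<and> (\<forall>w\<in>W k. g (h w) = w) \<and>
      (\<forall>z\<in>D_hat. g z \<in> W k \<longrightarrow> h (g z) = z)" if "q_hat \<in> W k" for k
  proof (rule limit_local_inverse[where k = k and g = g, OF assms(1-7)])
    show "q_hat \<in> connected_component_set (interior (\<Inter>j\<in>{k..}. G j)) q_hat"
      using that by (simp add: W_def)
  next
    fix h
    let ?W = "connected_component_set (interior (\<Inter>j\<in>{k..}. G j)) q_hat"
    let ?D = "connected_component_set (eventual_interior D) p_hat"
    assume "g ` ?D \<subseteq> connected_component_set (eventual_interior G) q_hat" "g p_hat = q_hat"
      "holomorphic_map_on g ?D" "holomorphic_map_on h ?W" "h ` ?W \<subseteq> ?D"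
      "\<And>w. w \<in> ?W \<Longrightarrow> g (h w) = w" "\<And>z. z \<in> ?D \<Longrightarrow> g z \<in> ?W \<Longrightarrow> h (g z) = z"
    then show ?thesis
      unfolding W_def D_hat_def G_hat_def by (intro exI[of _ h] conjI ballI impI) assumption+
  qed (rule lim)
  have W_G_hat: "(\<Union>k. W k) = G_hat"
    unfolding W_def G_hat_def by (simp add: connected_component_eventual_interior)
  \<comment> \<open>A component set is empty unless its base point belongs to the set, so every
    nonempty stage contains \<open>q_hat\<close>.\<close>
  have q_W: "q_hat \<in> W k" if "w \<in> W k" for w k
    using that unfolding W_def by (metis connected_component_in connected_component_refl_eq mem_Collect_eq)
  have "q_hat \<in> G_hat"
    using tamed_atD(4)[OF G] by (simp add: G_hat_def connected_component_refl_eq)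
  then obtain k0 where k0: "q_hat \<in> W k0"
    using W_G_hat by blast
  have g: "g ` D_hat \<subseteq> G_hat" "g p_hat = q_hat" "holomorphic_map_on g D_hat"
    using local_inverse[OF k0] by - (elim exE conjE, assumption)+
  have inj: "inj_on g D_hat"
  proof (rule inj_onI)
    fix x y assume xy: "x \<in> D_hat" "y \<in> D_hat" "g x = g y"
    then obtain k where k: "g x \<in> W k"
      using g(1) W_G_hat by blast
    obtain h where "\<And>z. z \<in> D_hat \<Longrightarrow> g z \<in> W k \<Longrightarrow> h (g z) = z"
      using local_inverse[OF q_W[OF k]] by blast
    then show "x = y"
      using xy k by metis
  qed
  have surj: "w \<in> g ` D_hat" and hol: "\<exists>h'. (inv_into D_hat g has_derivative h') (at w within G_hat) \<and>
      (\<forall>c v. h' (c *s v) = c *s h' v)" if "w \<in> G_hat" for w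
  proof -
    obtain k where k: "w \<in> W k"
      using \<open>w \<in> G_hat\<close> W_G_hat by blast
    obtain h where h: "holomorphic_map_on h (W k)" "h ` W k \<subseteq> D_hat" "\<And>w. w \<in> W k \<Longrightarrow> g (h w) = w"
      using local_inverse[OF q_W[OF k]] by blast
    show "w \<in> g ` D_hat"
      using h(2,3) k by (metis image_eqI image_subset_iff)
    have "open (W k)"
      by (simp add: W_def open_connected_component)
    \<comment> \<open>Global injectivity forces each local inverse to agree with the global one, so
      its derivative can be taken over.\<close>
    have "h v = inv_into D_hat g v" if "v \<in> W k" for v
      using inv_into_f_f[OF inj, of "h v"] h(2,3) that by auto
    moreover obtain h' where "(h has_derivative h') (at w)" "\<forall>c v. h' (c *s v) = c *s h' v"
      using h(1) k \<open>open (W k)\<close> unfolding holomorphic_map_on_def by (metis at_within_open)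
    ultimately show "\<exists>h'. (inv_into D_hat g has_derivative h') (at w within G_hat) \<and>
      (\<forall>c v. h' (c *s v) = c *s h' v)"
      using has_derivative_transform_within_open[OF _ \<open>open (W k)\<close> k] has_derivative_at_withinI by blast
  qed
  have "bij_betw g D_hat G_hat"
    using inj surj g(1) by (auto simp: bij_betw_def)
  then show ?thesis
    using g hol by (auto simp: biholomorphic_map_def holomorphic_map_on_def)
qed

section \<open>A common subsequence for both sequences of domains\<close>

theorem theorem4p6:
  fixes D G :: "nat \<Rightarrow> (complex^'n) set"
    and p q :: "nat \<Rightarrow> complex^'n"
    and p_hat q_hat :: "complex^'n"
    and D_taut G_taut :: "(complex^'n) set"
    and f :: "nat \<Rightarrow> complex^'n \<Rightarrow> complex^'n"
  assumes "tamed_at (\<lambda>j. (D j, p j)) p_hat"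
    and "tamed_at (\<lambda>j. (G j, q j)) q_hat"
    and "taut D_taut" and "taut G_taut"
    and "\<And>j. D j \<subseteq> D_taut" and "\<And>j. G j \<subseteq> G_taut"
    and "\<And>j. biholomorphic_map (f j) (D j) (G j)"
    and "\<And>j. f j (p j) = q j"
  shows "\<exists>r. strict_mono r \<and>
           converges_Caratheodory (\<lambda>k. (D (r k), p (r k))) p_hat \<and>
           converges_Caratheodory (\<lambda>k. (G (r k), q (r k))) q_hat \<and>
           (\<forall>D_hat G_hat f_hat.
              Ker p_hat (\<lambda>k. (D (r k), p (r k))) = (D_hat, p_hat) \<and>
              Ker q_hat (\<lambda>k. (G (r k), q (r k))) = (G_hat, q_hat) \<and>
              subsequential_limit D_hat (\<lambda>k. f (r k)) f_hat \<longrightarrow>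
              biholomorphic_map f_hat D_hat G_hat \<and> f_hat p_hat = q_hat)"
proof -
  \<comment> \<open>\<open>r1\<close> stabilizes the domains \<open>D\<close> and \<open>r2\<close>
    then the domains \<open>G\<close> along \<open>r1\<close>; stability of \<open>D\<close>
    survives the second extraction.\<close>
  obtain r1 where r1: "strict_mono r1" "subseq_stable (D \<circ> r1)"
    by (rule exists_subseq_stable)
  obtain r2 where r2: "strict_mono r2" "subseq_stable (G \<circ> r1 \<circ> r2)"
    by (rule exists_subseq_stable)
  define r where "r = r1 \<circ> r2"
  have r: "strict_mono r"
    unfolding r_def by (rule strict_mono_o[OF r1(1) r2(1)])
  have stable: "subseq_stable (\<lambda>k. D (r k))" "subseq_stable (\<lambda>k. G (r k))"
    using subseq_stable_subseq[OF r1(2) r2(1)] r2(2) by (auto simp: r_def o_def)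
  show ?thesis
  proof (intro exI[of _ r] conjI allI impI r subseq_stable_imp_converges stable)
    fix D_hat G_hat f_hat
    assume *: "Ker p_hat (\<lambda>k. (D (r k), p (r k))) = (D_hat, p_hat) \<and>
        Ker q_hat (\<lambda>k. (G (r k), q (r k))) = (G_hat, q_hat) \<and>
        subsequential_limit D_hat (\<lambda>k. f (r k)) f_hat"
    then obtain s where s: "strict_mono s"
      "\<And>K. compact K \<Longrightarrow> K \<subseteq> D_hat \<Longrightarrow> uniform_limit K (\<lambda>k. f (r (s k))) f_hat sequentially"
      unfolding subsequential_limit_def by blast
    have rs: "strict_mono (\<lambda>k. r (s k))"
      using strict_mono_o[OF r s(1)] by (simp add: o_def)
    \<comment> \<open>By stability the kernels along \<open>r\<close> and along
      \<open>r \<circ> s\<close> coincide, so \<open>f_hat\<close> can be treated as the limit of a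
      full sequence with the same kernels.\<close>
    have EI: "eventual_interior (\<lambda>k. D (r (s k))) = eventual_interior (\<lambda>k. D (r k))"
      "eventual_interior (\<lambda>k. G (r (s k))) = eventual_interior (\<lambda>k. G (r k))"
      using stable s(1) by (auto simp: subseq_stable_def o_def)
    have hat: "D_hat = connected_component_set (eventual_interior (\<lambda>k. D (r (s k)))) p_hat"
      "G_hat = connected_component_set (eventual_interior (\<lambda>k. G (r (s k)))) q_hat"
      using * by (simp_all add: Ker_eq EI)
    have "biholomorphic_map f_hat D_hat G_hat \<and> f_hat p_hat = q_hat"
      unfolding hat
    proof (rule limit_biholomorphic[where p = "\<lambda>k. p (r (s k))" and q = "\<lambda>k. q (r (s k))" and
          f = "\<lambda>k. f (r (s k))", OF tamed_at_subseq[OF assms(1) rs] tamed_at_subseq[OF assms(2) rs]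
          assms(3,5,7,8)])
      show "subseq_stable (\<lambda>k. D (r (s k)))"
        using subseq_stable_subseq[OF stable(1) s(1)] by (simp add: o_def)
      fix z assume "z \<in> connected_component_set (eventual_interior (\<lambda>k. D (r (s k)))) p_hat"
      \<comment> \<open>A closed ball inside the open kernel is compact, which turns convergence on
        compact sets into local uniform convergence.\<close>
      moreover have "open D_hat"
        by (simp add: hat open_connected_component open_eventual_interior)
      ultimately obtain R where "R > 0" "cball z R \<subseteq> D_hat"
        unfolding hat(1)[symmetric] open_contains_cball by blast
      then show "\<exists>R>0. uniform_limit (ball z R) (\<lambda>k. f (r (s k))) f_hat sequentially"
        using uniform_limit_on_subset[OF s(2)[OF compact_cball] ball_subset_cball] by blast
    qed
    then show "biholomorphic_map f_hat D_hat G_hat" "f_hat p_hat = q_hat"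
      by auto
  qed
qed

end
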